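(* Let $\delta>0$, $D=\{x\in\mathbb{R}^n: |x|>\delta\}$, and let $b\in C^1(D,\mathbb{R}^n)$ satisfy the conditions 1)–6) listed in the context, with constants $\check C,\alpha>0$ from condition 1) and with $r(\epsilon)=\left(\frac{1}{\check C\alpha\epsilon}\right)^{1/\alpha}$. For $x_0\in D$ and $\epsilon>0$, let $\bar\tau(x_0)$ be the output of the $n$-dimensional adaptive forward Euler algorithm described in the context with input $b,x_0,\alpha,\check C,\epsilon$. Then, for any $x_0\in D$ and any sufficiently small $\epsilon>0$, $$|\bar\tau(x_0)-\tau(x_0)|=\mathcal{O}(\epsilon)\qquad\text{and}\qquad \mathrm{Cost}(\bar\tau)=\mathcal{O}(\epsilon^{-1}).$$
   Context: Notation: $|\cdot|$ is the Euclidean norm on $\mathbb{R}^n$, $\|\cdot\|$ the induced matrix 2-norm, $b'$ the Jacobian of $b$, $B(\xi)=\{x:|x|<\xi\}$, and $D(\epsilon)=D\cap B(r(\epsilon))$. For $x_0\in D$, $x(t)$ denotes the solution of $\dot x=b(x)$, $x(0)=x_0$. The blow-up time is $\tau(x_0)=\inf\{t\ge0: \lim_{s\uparrow t}|x(s)|=\infty\}$, and $\tau_\epsilon(x_0)=\min\{t\ge0: |x(t)|\ge r(\epsilon)\}$. Conditions on $b$: 1) There exist $\check C,\alpha>0$ such that $\check C|x|^{2+\alpha}\le b(x)\cdot x$ for all $x\in D$. 2) There exists $C_1>0$ such that for any $\epsilon>0$ and all $x_0\in D(\epsilon)$, $|\nabla\tau_\epsilon(x_0)|\le \frac{C_1}{|b(x_0)|}$.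 3) At least one of the following holds: (a) there is a constant $C_2\in(0,1]$ such that $C_2\le\frac{b(x)\cdot x}{|b(x)||x|}$ for all $x\in D$; (b) for all $x\in D$, $x_ib_i(x)\ge0$ for $i\in\{1,\dots,n\}$. 4) There are constants $C_3,C_4>0$, $\nu>1$, $\upsilon\ge\max\{1-\alpha,0\}$ such that for $h>0$ sufficiently small, $\frac{\sqrt{\|b'(x)\|}}{|b(x+b(x)h)|}\le\frac{C_3}{|x+b(x)h|^{\nu}}$ and $\frac{\|b'(x)\|}{|b(x)|}\le\frac{C_4}{|x|^{\upsilon}}$ for all $x\in D$. 5) For $h>0$ sufficiently small, $|b(x)|\le|b(x+b(x)h)|$ for any $x\in D$. 6) There is a constant $k>1$ such that for any $\epsilon>0$, $\theta\in(0,1)$ and $x\in D(\epsilon)$, $\left\|b'\left(x+\frac{\epsilon}{\sqrt{\|b'(x)\|}}\theta b(x)\right)\right\|\le k\|b'(x)\|$. The $n$-dimensional adaptive algorithm (input $b,x_0,\alpha,\check C,\epsilon>0$): let $r(\epsilon)=\left(\frac{1}{\check C\alpha\epsilon}\right)^{1/\alpha}$, $\bar x_0=x_0$, $t_0=0$. As long as $|\bar x_n|\le r(\epsilon)$, set $$h_n=\frac{\epsilon}{\sqrt{\max\{\|b'(\bar x_n)\|,1\}}},\qquad \bar x_{n+1}=\bar x_n+b(\bar x_n)h_n,\qquad t_{n+1}=t_n+h_n.$$ Let $N$ be the first index $n$ with $|\bar x_n|>r(\epsilon)$. The output is $\bar\tau=\bar\tau(x_0)=t_N$ and $N$. $\mathrm{Cost}(\bar\tau)$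 is the number of iterations $N$. The notation $\mathcal{O}(\cdot)$ refers to the limit $\epsilon\downarrow0$, with constants independent of $\epsilon$. *)

theory Defs
  imports "HOL-Analysis.Analysis" "HOL-Library.Landau_Symbols"
begin

definition matrix_norm2 :: "real ^ 'n ^ 'm \<Rightarrow> real" where
  "matrix_norm2 A = onorm (\<lambda>v. A *v v)"

definition C1_on :: "(real ^ 'n) set \<Rightarrow> (real ^ 'n \<Rightarrow> real ^ 'n) \<Rightarrow> bool" where
  "C1_on D b \<longleftrightarrow> (\<forall>x\<in>D. b differentiable (at x)) \<and> continuous_on D (\<lambda>x. jacobian b (at x))"

subsection \<open>Solutions of the autonomous initial value problem and their blow-up time\<close>

text \<open>\<open>y\<close> is a solution in \<open>D\<close> on \<open>[0, T)\<close>, where \<open>T\<close> may be infinite; at time 0 the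
  derivative is one-sided. Values of \<open>y\<close> outside \<open>[0, T)\<close> are irrelevant.\<close>

definition ivp_solution ::
  "(real ^ 'n \<Rightarrow> real ^ 'n) \<Rightarrow> (real ^ 'n) set \<Rightarrow> real ^ 'n \<Rightarrow> (real \<Rightarrow> real ^ 'n) \<Rightarrow> ereal \<Rightarrow> bool"
where
  "ivp_solution b D x0 y T \<longleftrightarrow>
     0 < T \<and> y 0 = x0 \<and>
     (\<forall>t\<ge>0. ereal t < T \<longrightarrow>
        y t \<in> D \<and> (y has_vector_derivative b (y t)) (at t within {0..}))"

text \<open>Right end point of the maximal interval of existence.\<close>

definition lifespan ::
  "(real ^ 'n \<Rightarrow> real ^ 'n) \<Rightarrow> (real ^ 'n) set \<Rightarrow> real ^ 'n \<Rightarrow> ereal" where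
  "lifespan b D x0 = Sup {T. \<exists>y. ivp_solution b D x0 y T}"

text \<open>The value at time \<open>t\<close> of the maximal solution started at \<open>x0\<close>; meaningful only for
  \<open>0 \<le> t < lifespan b D x0\<close>.\<close>

definition solution ::
  "(real ^ 'n \<Rightarrow> real ^ 'n) \<Rightarrow> (real ^ 'n) set \<Rightarrow> real ^ 'n \<Rightarrow> real \<Rightarrow> real ^ 'n" where
  "solution b D x0 t = (THE v. \<exists>y T. ivp_solution b D x0 y T \<and> ereal t < T \<and> v = y t)"

text \<open>Valued in the extended reals, being infinite if there is no blow-up. The left limit at
  \<open>t = 0\<close> would involve negative times, where there is no solution; so only \<open>t > 0\<close> is admitted.\<close>

definition blowup_time ::
  "(real ^ 'n \<Rightarrow> real ^ 'n) \<Rightarrow> (real ^ 'n) set \<Rightarrow> real ^ 'n \<Rightarrow> ereal" where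
  "blowup_time b D x0 =
     Inf {ereal t | t. 0 < t \<and> ereal t \<le> lifespan b D x0 \<and>
                       filterlim (\<lambda>s. norm (solution b D x0 s)) at_top (at_left t)}"

definition hitting_time ::
  "(real ^ 'n \<Rightarrow> real ^ 'n) \<Rightarrow> (real ^ 'n) set \<Rightarrow> real \<Rightarrow> real ^ 'n \<Rightarrow> real" where
  "hitting_time b D r x0 =
     (LEAST t. 0 \<le> t \<and> ereal t < lifespan b D x0 \<and> r \<le> norm (solution b D x0 t))"

subsection \<open>The adaptive forward Euler algorithm\<close>

definition radius :: "real \<Rightarrow> real \<Rightarrow> real \<Rightarrow> real" where
  "radius c \<alpha> \<epsilon> = (1 / (c * \<alpha> * \<epsilon>)) powr (1 / \<alpha>)"

definition step_size :: "(real ^ 'n \<Rightarrow> real ^ 'n) \<Rightarrow> real \<Rightarrow> real ^ 'n \<Rightarrow> real" where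
  "step_size b \<epsilon> x = \<epsilon> / sqrt (max (matrix_norm2 (jacobian b (at x))) 1)"

text \<open>The recursion is continued for all \<open>n\<close>; only the indices up to \<open>euler_index\<close> below matter.\<close>

primrec euler_point ::
  "(real ^ 'n \<Rightarrow> real ^ 'n) \<Rightarrow> real \<Rightarrow> real ^ 'n \<Rightarrow> nat \<Rightarrow> real ^ 'n" where
  "euler_point b \<epsilon> x0 0 = x0"
| "euler_point b \<epsilon> x0 (Suc n) =
     euler_point b \<epsilon> x0 n
       + step_size b \<epsilon> (euler_point b \<epsilon> x0 n) *\<^sub>R b (euler_point b \<epsilon> x0 n)"

primrec euler_time ::
  "(real ^ 'n \<Rightarrow> real ^ 'n) \<Rightarrow> real \<Rightarrow> real ^ 'n \<Rightarrow> nat \<Rightarrow> real" where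
  "euler_time b \<epsilon> x0 0 = 0"
| "euler_time b \<epsilon> x0 (Suc n) = euler_time b \<epsilon> x0 n + step_size b \<epsilon> (euler_point b \<epsilon> x0 n)"

definition euler_terminates ::
  "(real ^ 'n \<Rightarrow> real ^ 'n) \<Rightarrow> real \<Rightarrow> real \<Rightarrow> real ^ 'n \<Rightarrow> real \<Rightarrow> bool" where
  "euler_terminates b c \<alpha> x0 \<epsilon> \<longleftrightarrow> (\<exists>n. radius c \<alpha> \<epsilon> < norm (euler_point b \<epsilon> x0 n))"

text \<open>The number of iterations; meaningful only if the algorithm terminates.\<close>

definition euler_index ::
  "(real ^ 'n \<Rightarrow> real ^ 'n) \<Rightarrow> real \<Rightarrow> real \<Rightarrow> real ^ 'n \<Rightarrow> real \<Rightarrow> nat" where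
  "euler_index b c \<alpha> x0 \<epsilon> = (LEAST n. radius c \<alpha> \<epsilon> < norm (euler_point b \<epsilon> x0 n))"

definition euler_blowup_time ::
  "(real ^ 'n \<Rightarrow> real ^ 'n) \<Rightarrow> real \<Rightarrow> real \<Rightarrow> real ^ 'n \<Rightarrow> real \<Rightarrow> real" where
  "euler_blowup_time b c \<alpha> x0 \<epsilon> = euler_time b \<epsilon> x0 (euler_index b c \<alpha> x0 \<epsilon>)"

end

theory Submission
  imports Defs
begin

text \<open>Along a solution the radial growth condition makes \<open>|y|\<close> raised to the power \<open>-\<alpha>\<close> decrease at rate at
least \<open>c \<alpha>\<close> (\<open>norm_powr_decay\<close>). Hence a maximal solution exists only for a finite time, it stays
away from the inner boundary of \<open>D\<close>, and by the continuation principle it leaves every ball: its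
lifespan is its blow-up time. The same estimate shows that from the sphere of radius \<open>r(\<epsilon>)\<close> the
remaining time to blow-up is at most \<open>\<epsilon>\<close>; the radius is chosen for exactly this purpose.

It remains to compare the Euler time with the hitting time \<open>H\<close> of the sphere. Since \<open>H\<close> decreases at
unit speed along the flow, its gradient satisfies \<open>b(x) \<bullet> grad H(x) = -1\<close>. Therefore the derivative
of \<open>H(x + u b(x)) + u\<close> in \<open>u\<close> is \<open>(b(x) - b(x + u b(x))) \<bullet> grad H\<close>, taken at \<open>x + u b(x)\<close>. The gradient
bound, the monotonicity of \<open>|b|\<close> along Euler steps and the control of the Jacobian along a step bound
this by a multiple of \<open>u |b'(x)|\<close>. A step has \<open>h\<^sup>2 |b'(x)| \<le> \<epsilon>\<^sup>2\<close>, so it contributes an error of order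
\<open>\<epsilon>\<^sup>2\<close> (\<open>euler_step_error\<close>); the step that crosses the sphere costs only \<open>O(\<epsilon>)\<close>
(\<open>hitting_time_le_last_step\<close>). With \<open>O(1/\<epsilon>)\<close> steps the total error is \<open>O(\<epsilon>)\<close>.

The number of steps is bounded through a potential. Both alternatives of the third condition provide
a size function \<open>S\<close>, equivalent to the norm, that grows in each step by a fixed fraction of the
length of that step: the Euclidean norm in case (a), the sum norm in case (b). The fourth condition,
in the limit \<open>h \<down> 0\<close>, and the growth of \<open>|b|\<close> where the Jacobian is small give
\<open>1 = h sqrt(max |b'(x)| 1) / \<epsilon> \<le> (K / \<epsilon>) h |b(x)| / |x|\<^sup>\<mu>\<close> with \<open>\<mu> > 1\<close>.
Were \<open>S\<close> evaluated at the end of the step, summing this would yield a lower Riemann sum of the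
integral of \<open>s\<^sup>-\<^sup>\<mu>\<close>, which converges at infinity. The two ends are comparable unless the step doubles
\<open>S\<close>, and at most \<open>O(log(1/\<epsilon>))\<close> steps can do so before \<open>r(\<epsilon>)\<close> is reached
(\<open>one_le_potential_drop\<close>).\<close>

section \<open>Local existence and uniqueness for ordinary differential equations\<close>

lemma has_real_derivative_inner_self:
  fixes w :: "real \<Rightarrow> 'a::real_inner"
  assumes "(w has_vector_derivative w') (at t within S)"
  shows "((\<lambda>t. w t \<bullet> w t) has_real_derivative 2 * (w t \<bullet> w')) (at t within S)"
proof -
  have "((\<lambda>t. w t \<bullet> w t) has_derivative (\<lambda>h. w t \<bullet> (h *\<^sub>R w') + (h *\<^sub>R w') \<bullet> w t)) (at t within S)"
    using assms unfolding has_vector_derivative_def by (intro has_derivative_inner) auto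
  moreover have "(\<lambda>h. w t \<bullet> (h *\<^sub>R w') + (h *\<^sub>R w') \<bullet> w t) = (*) (2 * (w t \<bullet> w'))"
    by (auto simp: inner_commute)
  ultimately show ?thesis
    by (simp add: has_field_derivative_def)
qed

text \<open>Picard iteration on the bounded continuous functions on the line. Composing \<open>f\<close> with the nearest-point
projection onto the ball makes it globally Lipschitz with the same constant, so that the iteration
is defined everywhere; the bound \<open>a * M \<le> \<rho>\<close> then confines the fixed point to the ball, where the
projection is the identity. The existence time depends only on \<open>L\<close>, \<open>M\<close> and \<open>\<rho>\<close>, not on the centre.\<close>

lemma picard_lindelof_local:
  fixes f :: "'a::euclidean_space \<Rightarrow> 'a"
  assumes lip: "L-lipschitz_on (cball p \<rho>) f"
    and bd: "\<And>x. x \<in> cball p \<rho> \<Longrightarrow> norm (f x) \<le> M"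
    and \<rho>: "0 < \<rho>" and a: "0 < a" "a * L < 1" "a * M \<le> \<rho>"
  obtains z where "z 0 = p" "\<And>t. t \<in> {0..a} \<Longrightarrow> z t \<in> cball p \<rho>"
    "\<And>t. t \<in> {0..a} \<Longrightarrow> (z has_vector_derivative f (z t)) (at t within {0..a})"
proof -
  have L0: "0 \<le> L" using lip by (rule lipschitz_on_nonneg)
  define F where "F = f \<circ> closest_point (cball p \<rho>)"
  \<comment> \<open>Truncating time to \<open>[0, a]\<close> makes the iterates bounded functions on the whole line.\<close>
  define m where "m t = max 0 (min a t)" for t :: real
  have cp: "closest_point (cball p \<rho>) x \<in> cball p \<rho>" for x
    using \<rho> by (intro closest_point_in_set) auto
  have F_lip: "norm (F x - F y) \<le> L * norm (x - y)" for x y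
  proof -
    have "norm (F x - F y) \<le> L * dist (closest_point (cball p \<rho>) x) (closest_point (cball p \<rho>) y)"
      using lipschitz_onD[OF lip cp cp] by (simp add: F_def dist_norm)
    also have "\<dots> \<le> L * dist x y"
      using \<rho> L0 by (intro mult_left_mono closest_point_lipschitz) auto
    finally show ?thesis by (simp add: dist_norm)
  qed
  have F_bd: "norm (F x) \<le> M" for x
    using bd[OF cp] by (simp add: F_def)
  have M0: "0 \<le> M" using F_bd[of p] norm_ge_zero order_trans by blast
  have F_cont: "continuous_on UNIV F"
    using F_lip L0
    by (intro lipschitz_on_continuous_on[of L]) (auto simp: lipschitz_on_def dist_norm)
  have Ff: "continuous_on S (\<lambda>s. F (apply_bcontfun u s))" for S and u :: "real \<Rightarrow>\<^sub>C 'a"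
    using continuous_on_compose2[OF F_cont continuous_on_apply_bcontfun] by auto
  have Fi: "(\<lambda>s. F (apply_bcontfun u s)) integrable_on {0..t}" for t and u :: "real \<Rightarrow>\<^sub>C 'a"
    by (rule integrable_continuous_real[OF Ff])
  have m: "m t \<in> {0..a}" for t using a by (auto simp: m_def)
  have m_cont: "continuous_on UNIV m"
    unfolding m_def by (intro continuous_intros)
  define P where "P u t = p + integral {0..m t} (\<lambda>s. F (apply_bcontfun u s))" for u t
  have step_bd: "norm (integral {0..m t} (\<lambda>s. F (apply_bcontfun u s))) \<le> \<rho>" for u t
  proof -
    have "norm (integral {0..m t} (\<lambda>s. F (apply_bcontfun u s))) \<le> M * (m t - 0)"
      using m[of t] by (intro integral_bound Ff) (auto simp: F_bd)
    also have "\<dots> \<le> M * a" using m[of t] M0 by (intro mult_left_mono) auto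
    finally show ?thesis using a by (simp add: mult.commute)
  qed
  have P_cont: "continuous_on UNIV (P u)" for u
  proof -
    have "continuous_on {0..a} (\<lambda>t. integral {0..t} (\<lambda>s. F (apply_bcontfun u s)))"
      by (rule indefinite_integral_continuous_1[OF Fi])
    then have "continuous_on UNIV (\<lambda>t. integral {0..m t} (\<lambda>s. F (apply_bcontfun u s)))"
      by (rule continuous_on_compose2[OF _ m_cont]) (use m in auto)
    then show ?thesis unfolding P_def by (intro continuous_intros)
  qed
  have P_b: "P u \<in> bcontfun" for u
  proof (rule bcontfun_normI[OF P_cont])
    show "norm (P u t) \<le> norm p + \<rho>" for t
      unfolding P_def using norm_triangle_ineq step_bd by (meson add_left_mono order_trans)
  qed
  define \<Phi> where "\<Phi> u = Bcontfun (P u)" for u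
  have \<Phi>: "apply_bcontfun (\<Phi> u) = P u" for u
    unfolding \<Phi>_def by (rule Bcontfun_inverse[OF P_b])
  have contr: "dist (\<Phi> u) (\<Phi> v) \<le> (a * L) * dist u v" for u v
  proof (rule dist_bound)
    fix t
    have "P u t - P v t = integral {0..m t} (\<lambda>s. F (apply_bcontfun u s) - F (apply_bcontfun v s))"
      unfolding P_def by (simp add: integral_diff[OF Fi Fi])
    also have "norm \<dots> \<le> (L * dist u v) * (m t - 0)"
    proof (rule integral_bound)
      fix s
      have "norm (F (apply_bcontfun u s) - F (apply_bcontfun v s)) \<le> L * dist (apply_bcontfun u s) (apply_bcontfun v s)"
        using F_lip by (simp add: dist_norm)
      also have "\<dots> \<le> L * dist u v" by (intro mult_left_mono L0 dist_bounded)
      finally show "norm (F (apply_bcontfun u s) - F (apply_bcontfun v s)) \<le> L * dist u v" .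
    qed (use m[of t] in \<open>auto intro!: continuous_intros Ff\<close>)
    also have "\<dots> \<le> (L * dist u v) * a"
      using m[of t] L0 by (intro mult_left_mono) auto
    finally show "dist (apply_bcontfun (\<Phi> u) t) (apply_bcontfun (\<Phi> v) t) \<le> a * L * dist u v"
      by (simp add: \<Phi> dist_norm mult_ac)
  qed
  have "\<exists>!u. \<Phi> u = u"
  proof (rule banach_fix_type)
    show "0 \<le> a * L" "a * L < 1" using a L0 by simp_all
    show "\<forall>u v. dist (\<Phi> u) (\<Phi> v) \<le> a * L * dist u v" using contr by (intro allI)
  qed
  from ex1_implies_ex[OF this] obtain u where u: "\<Phi> u = u" ..
  define z where "z = apply_bcontfun u"
  have z: "z t = p + integral {0..m t} (\<lambda>s. F (z s))" for t
    using fun_cong[OF \<Phi>[of u, unfolded u], of t] unfolding z_def P_def .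
  have z_ball: "z t \<in> cball p \<rho>" for t
  proof -
    have "norm (z t - p) \<le> \<rho>"
      using step_bd[of t u] by (subst z) (simp add: z_def)
    then show ?thesis by (simp add: dist_norm norm_minus_commute)
  qed
  have Fz: "F (z t) = f (z t)" for t
    using z_ball[of t] by (simp add: F_def closest_point_self)
  have der: "(z has_vector_derivative f (z t)) (at t within {0..a})" if t: "t \<in> {0..a}" for t
  proof -
    have "((\<lambda>t. p + integral {0..t} (\<lambda>s. F (z s))) has_vector_derivative 0 + F (z t)) (at t within {0..a})"
      using Ff[of "{0..a}" u] t unfolding z_def
      by (intro has_vector_derivative_add has_vector_derivative_const integral_has_vector_derivative)
    then have "(z has_vector_derivative 0 + F (z t)) (at t within {0..a})"
    proof (rule has_vector_derivative_transform[OF t, rotated])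
      show "z x = p + integral {0..x} (\<lambda>s. F (z s))" if "x \<in> {0..a}" for x
        using that by (subst z) (simp add: m_def)
    qed
    then show ?thesis by (simp add: Fz)
  qed
  have "z 0 = p" using a by (subst z) (simp add: m_def)
  from that[OF this z_ball der] show ?thesis .
qed

text \<open>Gronwall's argument: \<open>exp(- 2 L t) |y - z|\<^sup>2\<close> does not increase.\<close>

lemma ode_unique_lipschitz:
  fixes f :: "'a::real_inner \<Rightarrow> 'a"
  assumes lip: "L-lipschitz_on K f"
    and K: "\<And>t. t \<in> {0..T} \<Longrightarrow> y t \<in> K" "\<And>t. t \<in> {0..T} \<Longrightarrow> z t \<in> K"
    and y: "\<And>t. t \<in> {0..T} \<Longrightarrow> (y has_vector_derivative f (y t)) (at t within {0..T})"
    and z: "\<And>t. t \<in> {0..T} \<Longrightarrow> (z has_vector_derivative f (z t)) (at t within {0..T})"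
    and init: "y 0 = z 0" and T: "0 \<le> T"
  shows "y T = z T"
proof -
  define w where "w t = y t - z t" for t
  define \<phi> where "\<phi> t = exp (- (2 * L * t)) * (w t \<bullet> w t)" for t
  have w: "(w has_vector_derivative f (y t) - f (z t)) (at t within {0..T})" if "t \<in> {0..T}" for t
    unfolding w_def using y[OF that] z[OF that] by (rule has_vector_derivative_diff)
  have d: "(\<phi> has_real_derivative
      exp (- (2 * L * t)) * (2 * (w t \<bullet> (f (y t) - f (z t))) - 2 * L * (w t \<bullet> w t))) (at t within {0..T})"
    if "t \<in> {0..T}" for t
    unfolding \<phi>_def
    by (rule derivative_eq_intros has_real_derivative_inner_self[OF w[OF that]] refl)+
      (simp add: algebra_simps)
  have "\<phi> T \<le> \<phi> 0"
  proof (rule DERIV_nonpos_imp_decreasing_open[OF T])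
    show "continuous_on {0..T} \<phi>"
      by (rule DERIV_continuous_on[OF d])
    fix t assume t: "0 < t" "t < T"
    have "w t \<bullet> (f (y t) - f (z t)) \<le> norm (w t) * norm (f (y t) - f (z t))"
      by (rule norm_cauchy_schwarz)
    also have "\<dots> \<le> norm (w t) * (L * norm (w t))"
      using lipschitz_onD[OF lip K(1) K(2), of t t] t
      by (intro mult_left_mono) (auto simp: w_def dist_norm)
    finally have "w t \<bullet> (f (y t) - f (z t)) \<le> L * (w t \<bullet> w t)"
      by (simp add: power2_norm_eq_inner[symmetric] power2_eq_square mult_ac)
    then have "exp (- (2 * L * t)) * (2 * (w t \<bullet> (f (y t) - f (z t))) - 2 * L * (w t \<bullet> w t)) \<le> 0"
      by (intro mult_nonneg_nonpos) auto
    moreover have "at t within {0..T} = at t"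
      using t by (rule at_within_Icc_at)
    ultimately show "\<exists>y. (\<phi> has_real_derivative y) (at t) \<and> y \<le> 0"
      using d[of t] t by auto
  qed
  then have "exp (- (2 * L * T)) * (w T \<bullet> w T) \<le> 0"
    using init by (simp add: \<phi>_def w_def)
  then have "w T \<bullet> w T \<le> 0"
    by (simp add: mult_le_0_iff)
  then have "w T = 0"
    by (metis antisym inner_eq_zero_iff inner_ge_zero)
  then show ?thesis by (simp add: w_def)
qed

section \<open>The induced matrix norm\<close>

lemma norm_matrix_vector_le: "norm (A *v x) \<le> matrix_norm2 A * norm x"
  unfolding matrix_norm2_def by (rule onorm) (rule matrix_vector_mul_bounded_linear)

lemma matrix_norm2_nonneg: "0 \<le> matrix_norm2 A"
  unfolding matrix_norm2_def by (rule onorm_pos_le) (rule matrix_vector_mul_bounded_linear)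

lemma abs_matrix_norm2_diff_le: "\<bar>matrix_norm2 A - matrix_norm2 B\<bar> \<le> matrix_norm2 (A - B)"
proof -
  have *: "matrix_norm2 A \<le> matrix_norm2 B + matrix_norm2 (A - B)" for A B :: "real^'n^'m"
  proof -
    have "(\<lambda>v. A *v v) = (\<lambda>v. B *v v + (A - B) *v v)"
      by (simp add: matrix_vector_mult_diff_rdistrib)
    then show ?thesis
      unfolding matrix_norm2_def
      by (simp only:) (rule onorm_triangle; rule matrix_vector_mul_bounded_linear)
  qed
  have "(\<lambda>v. (B - A) *v v) = (\<lambda>v. - ((A - B) *v v))"
    by (simp add: matrix_vector_mult_diff_rdistrib)
  then have "matrix_norm2 (B - A) = matrix_norm2 (A - B)"
    unfolding matrix_norm2_def by (simp only: onorm_neg)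
  then show ?thesis using *[of A B] *[of B A] by linarith
qed

lemma matrix_norm2_le_norm:
  fixes A :: "real^'n^'m"
  shows "matrix_norm2 A \<le> real CARD('m) * real CARD('n) * norm A"
  unfolding matrix_norm2_def
proof (rule onorm_le_matrix_component)
  show "\<bar>A $ i $ j\<bar> \<le> norm A" for i j
    using component_le_norm_cart[of "A $ i" j] Finite_Cartesian_Product.norm_nth_le[of A i] by simp
qed

lemma continuous_on_matrix_norm2:
  fixes f :: "'a::metric_space \<Rightarrow> real^'n^'m"
  assumes "continuous_on S f"
  shows "continuous_on S (\<lambda>x. matrix_norm2 (f x))"
proof -
  have "continuous_on UNIV (matrix_norm2 :: real^'n^'m \<Rightarrow> real)"
  proof (rule lipschitz_on_continuous_on)
    show "(real CARD('m) * real CARD('n))-lipschitz_on UNIV (matrix_norm2 :: real^'n^'m \<Rightarrow> real)"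
      by (rule lipschitz_onI)
        (auto simp: dist_norm intro: order_trans[OF abs_matrix_norm2_diff_le matrix_norm2_le_norm])
  qed
  then show ?thesis
    using assms by (rule continuous_on_compose2) auto
qed

section \<open>Solutions of a radially superlinear field\<close>

text \<open>The first condition of the theorem, on a \<open>C\<^sup>1\<close> vector field outside a ball.\<close>

locale superlinear_field =
  fixes b :: "real ^ 'n \<Rightarrow> real ^ 'n" and D :: "(real ^ 'n) set" and \<delta> c \<alpha> :: real
  assumes delta: "\<delta> > 0"
    and D: "D = {x. \<delta> < norm x}"
    and C1: "C1_on D b"
    and c_pos: "c > 0" and alpha_pos: "\<alpha> > 0"
    and growth: "x \<in> D \<Longrightarrow> c * norm x powr (2 + \<alpha>) \<le> b x \<bullet> x"
begin

lemma norm_pos: "x \<in> D \<Longrightarrow> 0 < norm x"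
  using delta by (auto simp: D intro: less_trans)

lemma open_D: "open D"
  unfolding D by (intro open_Collect_less continuous_intros)

lemma has_derivative_b: "x \<in> D \<Longrightarrow> (b has_derivative (\<lambda>v. jacobian b (at x) *v v)) (at x)"
  using C1 by (auto simp: C1_on_def jacobian_works[symmetric])

lemma continuous_on_b: "continuous_on D b"
  by (intro continuous_at_imp_continuous_on ballI has_derivative_continuous[OF has_derivative_b])

lemma norm_b_ge: "x \<in> D \<Longrightarrow> c * norm x powr (1 + \<alpha>) \<le> norm (b x)"
proof -
  assume x: "x \<in> D"
  have "(c * norm x powr (1 + \<alpha>)) * norm x = c * norm x powr (2 + \<alpha>)"
    using norm_pos[OF x] powr_mult_base[of "norm x" "1 + \<alpha>"] by (simp add: mult_ac add.assoc)
  also have "\<dots> \<le> norm (b x) * norm x"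
    using growth[OF x] norm_cauchy_schwarz[of "b x" x] by linarith
  finally show ?thesis using norm_pos[OF x] by simp
qed

lemma norm_b_pos: "x \<in> D \<Longrightarrow> 0 < norm (b x)"
  using norm_b_ge[of x] norm_pos[of x] c_pos
  by (smt (verit) mult_pos_pos powr_gt_zero)

lemma inner_b_nonneg: "x \<in> D \<Longrightarrow> 0 \<le> b x \<bullet> x"
  using growth[of x] c_pos by (smt (verit) mult_nonneg_nonneg powr_ge_zero)

lemma lipschitz_on_compact:
  assumes K: "compact K" "K \<subseteq> D"
  obtains L where "L-lipschitz_on K b"
proof -
  define f' where "f' z = Blinfun (\<lambda>v. jacobian b (at (snd z)) *v v)" for z :: "real \<times> (real^'n)"
  have f': "blinfun_apply (f' z) = (\<lambda>v. jacobian b (at (snd z)) *v v)" for z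
    unfolding f'_def by (rule bounded_linear_Blinfun_apply) (rule matrix_vector_mul_bounded_linear)
  have "local_lipschitz UNIV D (\<lambda>_::real. b)"
  proof (rule c1_implies_local_lipschitz)
    show "(b has_derivative blinfun_apply (f' (t, x))) (at x)" if "x \<in> D" for t x
      using has_derivative_b[OF that] by (simp add: f')
    show "continuous_on (UNIV \<times> D) f'"
    proof (rule continuous_on_blinfun_componentwise)
      fix v :: "real^'n"
      have "continuous_on D (\<lambda>x. jacobian b (at x) *v v)"
        using C1 unfolding C1_on_def matrix_vector_mult_def
        by (intro continuous_on_vec_lambda continuous_intros) auto
      from continuous_on_compose2[OF this continuous_on_snd[OF continuous_on_id], of "UNIV \<times> D"]
      show "continuous_on (UNIV \<times> D) (\<lambda>z. blinfun_apply (f' z) v)"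
        by (auto simp: f')
    qed
  qed (use open_D in auto)
  then have "local_lipschitz UNIV K (\<lambda>_::real. b)"
    by (rule local_lipschitz_subset) (use K in auto)
  then obtain L where "\<And>t. t \<in> {0} \<Longrightarrow> L-lipschitz_on K b"
    by (rule local_lipschitz_compact_implies_lipschitz[where T = "{0::real}", OF local_lipschitz_subset])
      (use K in auto)
  then show ?thesis using that by blast
qed

lemma ivp_derivative:
  assumes "ivp_solution b D x y (ereal T)" "0 \<le> t" "t < T"
  shows "(y has_vector_derivative b (y t)) (at t within {0..})" "y t \<in> D"
  using assms by (auto simp: ivp_solution_def)

lemma ivp_continuous:
  assumes "ivp_solution b D x y (ereal T)" "S \<subseteq> {0..<T}"
  shows "continuous_on S y"
  unfolding continuous_on_eq_continuous_within
proof
  fix t assume "t \<in> S"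
  with assms have t: "0 \<le> t" "t < T" by auto
  have "continuous (at t within {0..}) y"
    using ivp_derivative(1)[OF assms(1) t] by (rule has_vector_derivative_continuous)
  then show "continuous (at t within S) y"
    by (rule continuous_within_subset) (use assms(2) in auto)
qed

lemma ivp_mono_time:
  assumes "ivp_solution b D x y T" "0 < T'" "T' \<le> T"
  shows "ivp_solution b D x y T'"
  using assms unfolding ivp_solution_def by (meson order_less_le_trans)

lemma ivp_start:
  assumes "ivp_solution b D x y T"
  shows "y 0 = x" "x \<in> D" "0 < T"
  using assms unfolding ivp_solution_def zero_ereal_def by auto

lemma ivp_unique_real:
  assumes y: "ivp_solution b D x y (ereal T)" and z: "ivp_solution b D x z (ereal T)"
    and t: "0 \<le> t" "t < T"
  shows "y t = z t"
proof -
  have sub: "{0..t} \<subseteq> {0..<T}" using t by auto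
  have "compact (y ` {0..t} \<union> z ` {0..t})"
    using ivp_continuous[OF y sub] ivp_continuous[OF z sub]
    by (intro compact_Un compact_continuous_image) auto
  moreover have "y ` {0..t} \<union> z ` {0..t} \<subseteq> D"
    using ivp_derivative(2)[OF y] ivp_derivative(2)[OF z] t by auto
  ultimately obtain L where L: "L-lipschitz_on (y ` {0..t} \<union> z ` {0..t}) b"
    by (rule lipschitz_on_compact)
  show ?thesis
  proof (rule ode_unique_lipschitz[OF L])
    fix s assume s: "s \<in> {0..t}"
    show "(y has_vector_derivative b (y s)) (at s within {0..t})"
      using ivp_derivative(1)[OF y, of s] s t
      by (auto intro: has_vector_derivative_within_subset)
    show "(z has_vector_derivative b (z s)) (at s within {0..t})"
      using ivp_derivative(1)[OF z, of s] s t
      by (auto intro: has_vector_derivative_within_subset)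
  qed (use t ivp_start(1)[OF y] ivp_start(1)[OF z] in auto)
qed

lemma ivp_unique:
  assumes y: "ivp_solution b D x y T" and z: "ivp_solution b D x z T'"
    and t: "0 \<le> t" "ereal t < T" "ereal t < T'"
  shows "y t = z t"
proof -
  obtain T'' where T'': "ereal t < ereal T''" "ereal T'' < min T T'"
    using ereal_dense2[of "ereal t" "min T T'"] t by auto
  have "0 < T''" using T'' t by simp
  show ?thesis
    using T'' t(1)
    by (intro ivp_unique_real[of x y T'' z] ivp_mono_time[OF y] ivp_mono_time[OF z])
      (use \<open>0 < T''\<close> in \<open>auto simp: zero_ereal_def\<close>)
qed

text \<open>The basic a priori estimate. The derivative of \<open>|y|\<close> to the power \<open>-\<alpha>\<close> is \<open>- \<alpha> (b(y) \<bullet> y)\<close>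
divided by \<open>|y|\<close> to the power \<open>2 + \<alpha>\<close>, to which the growth condition applies.\<close>

lemma norm_powr_decay:
  assumes y: "ivp_solution b D x y (ereal T)" and st: "0 \<le> s" "s \<le> t" "t < T"
  shows "norm (y t) powr (- \<alpha>) \<le> norm (y s) powr (- \<alpha>) - c * \<alpha> * (t - s)"
proof -
  \<comment> \<open>Through the inner product, which avoids differentiating the norm.\<close>
  have rep: "norm v powr (- \<alpha>) = (v \<bullet> v) powr (- \<alpha> / 2)" for v :: "real^'n"
  proof -
    have "(v \<bullet> v) powr (- \<alpha> / 2) = (norm v powr 2) powr (- \<alpha> / 2)"
      by (simp add: power2_norm_eq_inner)
    also have "\<dots> = norm v powr (- \<alpha>)"
      by (simp only: powr_powr) simp
    finally show ?thesis ..
  qed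
  define g where "g u = (y u \<bullet> y u) powr (- \<alpha> / 2) + c * \<alpha> * u" for u
  define g' where "g' u = (- \<alpha> / 2) * (y u \<bullet> y u) powr (- \<alpha> / 2 - 1) * (2 * (y u \<bullet> b (y u))) + c * \<alpha>" for u
  have pos: "0 < y u \<bullet> y u" if "0 \<le> u" "u < T" for u
    using norm_pos[OF ivp_derivative(2)[OF y that]] by simp
  have der: "(g has_real_derivative g' u) (at u within {0..})" if u: "0 \<le> u" "u < T" for u
    unfolding g_def g'_def
    by (rule derivative_eq_intros has_real_derivative_inner_self[OF ivp_derivative(1)[OF y u]] pos[OF u] refl)+
      simp
  have "g t \<le> g s"
  proof (rule DERIV_nonpos_imp_decreasing_open[OF st(2)])
    show "continuous_on {s..t} g"
      by (rule DERIV_continuous_on[of _ _ g'], rule DERIV_subset[OF der]) (use st in auto)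
    fix u assume u: "s < u" "u < t"
    have yu: "y u \<in> D" using ivp_derivative(2)[OF y, of u] u st by simp
    let ?n = "norm (y u)"
    have n: "0 < ?n" using norm_pos[OF yu] .
    have "(y u \<bullet> y u) powr (- \<alpha> / 2 - 1) = (?n powr 2) powr (- \<alpha> / 2 - 1)"
      by (simp add: power2_norm_eq_inner)
    also have "\<dots> = ?n powr (- (2 + \<alpha>))"
      by (simp only: powr_powr) (simp add: algebra_simps)
    finally have e: "(y u \<bullet> y u) powr (- \<alpha> / 2 - 1) = ?n powr (- (2 + \<alpha>))" .
    have "c = ?n powr (- (2 + \<alpha>)) * (c * ?n powr (2 + \<alpha>))"
      using n by (simp add: powr_add[symmetric])
    also have "\<dots> \<le> ?n powr (- (2 + \<alpha>)) * (y u \<bullet> b (y u))"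
      using growth[OF yu] by (intro mult_left_mono) (auto simp: inner_commute)
    finally have "\<alpha> * c \<le> \<alpha> * (?n powr (- (2 + \<alpha>)) * (y u \<bullet> b (y u)))"
      using alpha_pos by (intro mult_left_mono) auto
    then have "g' u \<le> 0"
      unfolding g'_def e by (simp add: algebra_simps)
    moreover have "(g has_real_derivative g' u) (at u)"
      using der[of u] u st at_within_interior[of u "{0::real..}"] by (simp add: interior_Ici[of "-1"])
    ultimately show "\<exists>z. (g has_real_derivative z) (at u) \<and> z \<le> 0" by blast
  qed
  then show ?thesis by (simp add: g_def rep algebra_simps)
qed

lemma norm_powr_less_iff: "0 < u \<Longrightarrow> 0 < v \<Longrightarrow> u powr (- \<alpha>) < v powr (- \<alpha>) \<longleftrightarrow> v < u" for u v :: real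
  using alpha_pos powr_less_mono2_neg[of "- \<alpha>" u v] powr_less_mono2_neg[of "- \<alpha>" v u]
  by (cases u v rule: linorder_cases) auto

lemma ivp_norm_strict_mono:
  assumes y: "ivp_solution b D x y (ereal T)" and st: "0 \<le> s" "s < t" "t < T"
  shows "norm (y s) < norm (y t)"
proof -
  have "0 < c * \<alpha> * (t - s)" using c_pos alpha_pos st by simp
  then have "norm (y t) powr (- \<alpha>) < norm (y s) powr (- \<alpha>)"
    using norm_powr_decay[OF y st(1) _ st(3)] st by simp
  then show ?thesis
    using norm_pos[OF ivp_derivative(2)[OF y]] st by (subst (asm) norm_powr_less_iff) auto
qed

lemma ivp_time_bound:
  assumes y: "ivp_solution b D x y T"
  shows "T \<le> ereal (norm x powr (- \<alpha>) / (c * \<alpha>))"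
proof (rule ccontr)
  let ?B = "norm x powr (- \<alpha>) / (c * \<alpha>)"
  assume "\<not> ?thesis"
  then obtain T' where T': "ereal ?B < ereal T'" "ereal T' < T"
    using ereal_dense2[of "ereal ?B" T] by (auto simp: not_le)
  have B: "0 \<le> ?B" using c_pos alpha_pos by simp
  then have y': "ivp_solution b D x y (ereal T')"
    using T' by (intro ivp_mono_time[OF y]) (auto simp: zero_ereal_def)
  have "norm (y ?B) powr (- \<alpha>) \<le> norm (y 0) powr (- \<alpha>) - c * \<alpha> * (?B - 0)"
    using T' B by (intro norm_powr_decay[OF y']) auto
  also have "\<dots> = 0" using c_pos alpha_pos ivp_start(1)[OF y] by simp
  finally have "norm (y ?B) = 0" using powr_gt_zero[of "norm (y ?B)" "- \<alpha>"] by force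
  then show False using ivp_derivative(2)[OF y', of ?B] T' B norm_pos by force
qed

lemma ivp_shift:
  assumes y: "ivp_solution b D x y (ereal T)" and s: "0 \<le> s" "s < T"
  shows "ivp_solution b D (y s) (\<lambda>t. y (s + t)) (ereal (T - s))"
  unfolding ivp_solution_def
proof (intro conjI allI impI)
  fix t assume t: "0 \<le> t" "ereal t < ereal (T - s)"
  then have st: "0 \<le> s + t" "s + t < T" using s by auto
  show "y (s + t) \<in> D" using ivp_derivative(2)[OF y st] .
  have "(y has_vector_derivative b (y (s + t))) (at (s + t) within (\<lambda>t. s + t) ` {0..})"
    by (rule has_vector_derivative_within_subset[OF ivp_derivative(1)[OF y st]]) (use s in auto)
  moreover have "((\<lambda>t. s + t) has_vector_derivative 1) (at t within {0..})"
    unfolding has_real_derivative_iff_has_vector_derivative[symmetric]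
    by (auto intro!: derivative_eq_intros)
  ultimately have "((y \<circ> (\<lambda>t. s + t)) has_vector_derivative 1 *\<^sub>R b (y (s + t))) (at t within {0..})"
    by (intro vector_diff_chain_within)
  then show "((\<lambda>t. y (s + t)) has_vector_derivative b (y (s + t))) (at t within {0..})"
    by (simp add: o_def)
qed (use s in \<open>auto simp: zero_ereal_def\<close>)

text \<open>The second solution starts at an interior time \<open>s\<close> of the first one, and by uniqueness the two agree
until time \<open>T\<close>. Switching at \<open>T\<close> therefore needs no matching of one-sided derivatives.\<close>

lemma ivp_glue:
  assumes y: "ivp_solution b D x y (ereal T)" and s: "0 \<le> s" "s < T"
    and z: "ivp_solution b D (y s) z (ereal T')"
  shows "ivp_solution b D x (\<lambda>t. if t < T then y t else z (t - s)) (ereal (s + T'))" (is "ivp_solution b D x ?w _")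
proof -
  have T': "0 < T'" using ivp_start(3)[OF z] by (simp add: zero_ereal_def)
  have overlap: "?w t = z (t - s)" if t: "s \<le> t" "t < s + T'" for t
  proof (cases "t < T")
    case True
    have "y (s + (t - s)) = z (t - s)"
      using True t by (intro ivp_unique[OF ivp_shift[OF y s] z]) auto
    then show ?thesis using True by simp
  qed simp
  show ?thesis
    unfolding ivp_solution_def
  proof (intro conjI allI impI)
    show "0 < ereal (s + T')" using s T' by (simp add: zero_ereal_def)
    show "?w 0 = x" using s ivp_start(1)[OF y] by simp
    fix t assume t: "0 \<le> t" "ereal t < ereal (s + T')"
    show "?w t \<in> D"
      using ivp_derivative(2)[OF y, of t] ivp_derivative(2)[OF z, of "t - s"] t s by auto
    show "(?w has_vector_derivative b (?w t)) (at t within {0..})"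
    proof (cases "t < T")
      case True
      have "(?w has_vector_derivative b (y t)) (at t within {0..})"
        by (rule has_vector_derivative_transform_within[OF ivp_derivative(1)[OF y t(1) True], of "T - t"])
          (use True t in \<open>auto simp: dist_real_def\<close>)
      then show ?thesis using True by simp
    next
      case False
      then have st: "s < t" "0 \<le> t - s" "t - s < T'" using s t by auto
      have "at (t - s) within {0..} = at (t - s)"
        using st by (intro at_within_interior) (simp add: interior_Ici[of "-1"])
      then have "(z has_vector_derivative b (z (t - s))) (at (t - s))"
        using ivp_derivative(1)[OF z st(2,3)] by simp
      moreover have "((\<lambda>u. u - s) has_vector_derivative 1) (at t)"
        unfolding has_real_derivative_iff_has_vector_derivative[symmetric]
        by (auto intro!: derivative_eq_intros)
      ultimately have "(z \<circ> (\<lambda>u. u - s) has_vector_derivative 1 *\<^sub>R b (z (t - s))) (at t)"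
        by (intro vector_diff_chain_at)
      then have "((\<lambda>u. z (u - s)) has_vector_derivative b (z (t - s))) (at t)"
        by (simp add: o_def)
      then have "(?w has_vector_derivative b (z (t - s))) (at t)"
      proof (rule has_vector_derivative_transform_within_open)
        show "open {s<..<s + T'}" by simp
        show "z (u - s) = ?w u" if "u \<in> {s<..<s + T'}" for u
          using overlap[of u] that by simp
      qed (use st in auto)
      then show ?thesis
        using False by (auto intro: has_vector_derivative_at_within)
    qed
  qed
qed

section \<open>Maximal solutions and blow-up\<close>

text \<open>One existence time serves a whole annulus, since the field is bounded and Lipschitz on a slightly
larger compact annulus inside \<open>D\<close>. This uniformity drives the continuation argument.\<close>

lemma uniform_local_existence:
  assumes m: "\<delta> < m"
  shows "\<exists>a>0. \<forall>p. m \<le> norm p \<longrightarrow> norm p \<le> R \<longrightarrow> (\<exists>z. ivp_solution b D p z (ereal a))"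
proof -
  define \<rho> where "\<rho> = (m - \<delta>) / 2"
  have \<rho>: "0 < \<rho>" using m by (simp add: \<rho>_def)
  define K where "K = {x :: real^'n. m - \<rho> \<le> norm x \<and> norm x \<le> R + \<rho>}"
  have K_D: "K \<subseteq> D" using m by (auto simp: K_def D \<rho>_def field_simps)
  have "closed K"
    unfolding K_def by (intro closed_Collect_conj closed_Collect_le continuous_intros)
  moreover have "bounded K"
    by (rule boundedI[of _ "R + \<rho>"]) (simp add: K_def)
  ultimately have K: "compact K" by (simp add: compact_eq_bounded_closed)
  obtain L where L: "L-lipschitz_on K b" using lipschitz_on_compact[OF K K_D] .
  have "compact (b ` K)"
    using continuous_on_b K_D K by (intro compact_continuous_image) (auto intro: continuous_on_subset)
  then obtain M where M: "0 < M" "\<And>x. x \<in> K \<Longrightarrow> norm (b x) \<le> M"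
    using bounded_pos[of "b ` K"] compact_imp_bounded by auto
  have L0: "0 \<le> L" using L by (rule lipschitz_on_nonneg)
  define a where "a = min (1 / (L + 1)) (\<rho> / M)"
  have "a * L < 1"
  proof -
    have "a * L \<le> 1 / (L + 1) * L" using L0 by (intro mult_right_mono) (auto simp: a_def)
    also have "\<dots> < 1" using L0 by (simp add: field_simps)
    finally show ?thesis .
  qed
  moreover have "a * M \<le> \<rho>"
    using M(1) by (simp add: a_def min_def field_simps split: if_splits)
  moreover have "0 < a" using L0 M(1) \<rho> by (simp add: a_def)
  ultimately have a: "0 < a" "a * L < 1" "a * M \<le> \<rho>" by blast+
  have "\<exists>z. ivp_solution b D p z (ereal a)" if p: "m \<le> norm p" "norm p \<le> R" for p
  proof -
    have sub: "cball p \<rho> \<subseteq> K"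
    proof
      fix x assume "x \<in> cball p \<rho>"
      then have "norm (p - x) \<le> \<rho>" by (simp add: dist_norm)
      then show "x \<in> K"
        using p norm_triangle_ineq2[of p x] norm_triangle_ineq2[of x p]
        by (simp add: K_def norm_minus_commute)
    qed
    obtain z where z: "z 0 = p" "\<And>t. t \<in> {0..a} \<Longrightarrow> z t \<in> cball p \<rho>"
      "\<And>t. t \<in> {0..a} \<Longrightarrow> (z has_vector_derivative b (z t)) (at t within {0..a})"
      using picard_lindelof_local[OF lipschitz_on_subset[OF L sub] _ \<rho> a] M(2) sub by blast
    have "ivp_solution b D p z (ereal a)"
      unfolding ivp_solution_def
    proof (intro conjI allI impI)
      fix t assume t: "0 \<le> t" "ereal t < ereal a"
      then show "z t \<in> D" using z(2)[of t] sub K_D by auto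
      have "at t within {0..a} = at t within {0..}"
        using t by (intro at_within_nhd[of _ "{..<a}"]) auto
      then show "(z has_vector_derivative b (z t)) (at t within {0..})"
        using z(3)[of t] t by simp
    qed (use a z in \<open>auto simp: zero_ereal_def\<close>)
    then show ?thesis by blast
  qed
  with a(1) show ?thesis by blast
qed

abbreviation "life x \<equiv> real_of_ereal (lifespan b D x)"
abbreviation "sol \<equiv> solution b D"

lemma ivp_le_lifespan: "ivp_solution b D x y T \<Longrightarrow> T \<le> lifespan b D x"
  unfolding lifespan_def by (intro Sup_upper) auto

lemma lifespan_finite:
  assumes x: "x \<in> D"
  shows "lifespan b D x = ereal (life x)" "0 < life x" "life x \<le> norm x powr (- \<alpha>) / (c * \<alpha>)"
proof -
  have le: "lifespan b D x \<le> ereal (norm x powr (- \<alpha>) / (c * \<alpha>))"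
    unfolding lifespan_def by (intro Sup_least) (auto dest: ivp_time_bound)
  have "\<delta> < norm x" using x by (simp add: D)
  then obtain a where a: "0 < a" "\<And>p. norm x \<le> norm p \<Longrightarrow> norm p \<le> norm x \<Longrightarrow> \<exists>z. ivp_solution b D p z (ereal a)"
    using uniform_local_existence[of "norm x" "norm x"] by blast
  then have "ereal a \<le> lifespan b D x" using ivp_le_lifespan by blast
  moreover have "0 < ereal a" using a(1) by (simp add: zero_ereal_def)
  ultimately have "0 < lifespan b D x" by (rule less_le_trans[rotated])
  then show "lifespan b D x = ereal (life x)" "0 < life x" "life x \<le> norm x powr (- \<alpha>) / (c * \<alpha>)"
    using le by (cases "lifespan b D x"; simp)+
qed

lemma solution_eq:
  assumes y: "ivp_solution b D x y T" and t: "0 \<le> t" "ereal t < T"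
  shows "sol x t = y t"
  unfolding solution_def
proof (rule the_equality)
  show "\<exists>y' T. ivp_solution b D x y' T \<and> ereal t < T \<and> y t = y' t" using y t by blast
qed (use ivp_unique[OF y _ t] in auto)

lemma ivp_solution_life:
  assumes x: "x \<in> D"
  shows "ivp_solution b D x (sol x) (ereal (life x))"
proof -
  have loc: "\<exists>y T. ivp_solution b D x y T \<and> ereal t < T" if "ereal t < ereal (life x)" for t
    using that lifespan_finite(1)[OF x] unfolding lifespan_def by (auto simp: less_Sup_iff)
  show ?thesis
    unfolding ivp_solution_def
  proof (intro conjI allI impI)
    show "0 < ereal (life x)" using lifespan_finite(2)[OF x] by (simp add: zero_ereal_def)
    obtain y T where y: "ivp_solution b D x y T" "ereal 0 < T"
      using loc[of 0] lifespan_finite(2)[OF x] by auto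
    show "sol x 0 = x" using solution_eq[OF y(1) _ y(2)] ivp_start(1)[OF y(1)] by simp
    fix t assume t: "0 \<le> t" "ereal t < ereal (life x)"
    obtain y T where y: "ivp_solution b D x y T" "ereal t < T" using loc[OF t(2)] by blast
    obtain T' where T': "ereal t < ereal T'" "ereal T' < T" using ereal_dense2[OF y(2)] by blast
    have y': "ivp_solution b D x y (ereal T')"
      using T' t by (intro ivp_mono_time[OF y(1)]) (auto simp: zero_ereal_def)
    have eq: "y s = sol x s" if "0 \<le> s" "s < T'" for s
      using solution_eq[OF y', of s] that by simp
    show "sol x t \<in> D" using ivp_derivative(2)[OF y', of t] eq[of t] t T' by simp
    have "(y has_vector_derivative b (y t)) (at t within {0..})"
      using ivp_derivative(1)[OF y', of t] t T' by simp
    then have "(sol x has_vector_derivative b (y t)) (at t within {0..})"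
      by (rule has_vector_derivative_transform_within[of _ _ _ _ "T' - t"])
        (use t T' eq in \<open>auto simp: dist_real_def\<close>)
    then show "(sol x has_vector_derivative b (sol x t)) (at t within {0..})"
      using eq[of t] t T' by simp
  qed
qed

lemma solution_in_D: "x \<in> D \<Longrightarrow> 0 \<le> t \<Longrightarrow> t < life x \<Longrightarrow> sol x t \<in> D"
  using ivp_derivative(2)[OF ivp_solution_life] .

lemma solution_0: "x \<in> D \<Longrightarrow> sol x 0 = x"
  using ivp_start(1)[OF ivp_solution_life] .

lemma solution_norm_mono:
  "x \<in> D \<Longrightarrow> 0 \<le> s \<Longrightarrow> s < t \<Longrightarrow> t < life x \<Longrightarrow> norm (sol x s) < norm (sol x t)"
  using ivp_norm_strict_mono[OF ivp_solution_life] .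

text \<open>Continuation principle: a solution confined to a ball could be restarted so close to the end of its
life that the uniform existence time exceeds the time left. Confinement to an annulus is automatic
because the norm increases.\<close>

lemma solution_unbounded:
  assumes x: "x \<in> D"
  shows "\<exists>t. 0 \<le> t \<and> t < life x \<and> R < norm (sol x t)"
proof (rule ccontr)
  assume "\<not> ?thesis"
  then have bd: "norm (sol x t) \<le> R" if "0 \<le> t" "t < life x" for t using that by force
  have "\<delta> < norm x" using x by (simp add: D)
  then obtain a where a: "0 < a" "\<And>p. norm x \<le> norm p \<Longrightarrow> norm p \<le> R \<Longrightarrow> \<exists>z. ivp_solution b D p z (ereal a)"
    using uniform_local_existence[of "norm x" R] by blast
  define s where "s = max 0 (life x - a / 2)"
  have s: "0 \<le> s" "s < life x" "life x < s + a"
    using a(1) lifespan_finite(2)[OF x] by (auto simp: s_def)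
  have "norm x \<le> norm (sol x s)"
    using solution_norm_mono[OF x, of 0 s] s solution_0[OF x] by (cases "s = 0") auto
  then obtain z where "ivp_solution b D (sol x s) z (ereal a)"
    using a(2) bd s by blast
  from ivp_le_lifespan[OF ivp_glue[OF ivp_solution_life[OF x] s(1,2) this]]
  show False using s(3) lifespan_finite(1)[OF x] by (metis ereal_less_eq(3) not_less)
qed

text \<open>A solution that becomes unbounded in finite time is maximal: an extension would have a
finite norm at that time, and the norm is increasing.\<close>

lemma lifespan_eqI:
  assumes y: "ivp_solution b D x y (ereal T)"
    and unb: "\<And>R. \<exists>t. 0 \<le> t \<and> t < T \<and> R < norm (y t)"
  shows "life x = T"
proof (rule ccontr)
  have x: "x \<in> D" using ivp_start(2)[OF y] .
  have T: "0 < T" using ivp_start(3)[OF y] by (simp add: zero_ereal_def)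
  assume "life x \<noteq> T"
  moreover have "T \<le> life x" using ivp_le_lifespan[OF y] lifespan_finite(1)[OF x]
    by (metis ereal_less_eq(3))
  ultimately have less: "T < life x" by simp
  obtain t where t: "0 \<le> t" "t < T" "norm (sol x T) < norm (y t)" using unb by blast
  then have "norm (sol x T) < norm (sol x t)" using solution_eq[OF y t(1)] by simp
  moreover have "norm (sol x t) < norm (sol x T)" by (rule solution_norm_mono[OF x t(1,2) less])
  ultimately show False by simp
qed

lemma solution_flow:
  assumes x: "x \<in> D" and s: "0 \<le> s" "s < life x"
  shows "life (sol x s) = life x - s"
    and "0 \<le> t \<Longrightarrow> t < life x - s \<Longrightarrow> sol (sol x s) t = sol x (s + t)"
proof -
  note sh = ivp_shift[OF ivp_solution_life[OF x] s]
  show "life (sol x s) = life x - s"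
  proof (rule lifespan_eqI[OF sh])
    fix R
    obtain t where t: "0 \<le> t" "t < life x" "max R (norm (sol x s)) < norm (sol x t)"
      using solution_unbounded[OF x] by blast
    have "s < t"
      using solution_norm_mono[OF x t(1), of s] t s by (cases s t rule: linorder_cases) auto
    then show "\<exists>t. 0 \<le> t \<and> t < life x - s \<and> R < norm (sol x (s + t))"
      using t by (intro exI[of _ "t - s"]) auto
  qed
  show "sol (sol x s) t = sol x (s + t)" if "0 \<le> t" "t < life x - s"
    using solution_eq[OF sh that(1)] that by simp
qed

text \<open>The norm is increasing, so unboundedness is divergence; at earlier times the norm is bounded by its
current value.\<close>

lemma blowup_time_eq_lifespan:
  assumes x: "x \<in> D"
  shows "blowup_time b D x = ereal (life x)"
proof -
  let ?N = "\<lambda>s. norm (sol x s)"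
  have top: "filterlim ?N at_top (at_left (life x))"
    unfolding filterlim_at_top
  proof
    fix Z
    obtain t where t: "0 \<le> t" "t < life x" "Z < ?N t" using solution_unbounded[OF x] by blast
    have "\<forall>\<^sub>F s in at_left (life x). s \<in> {t<..<life x}"
      using t(2) by (rule eventually_at_left_real)
    then show "\<forall>\<^sub>F s in at_left (life x). Z \<le> ?N s"
      by eventually_elim (use t solution_norm_mono[OF x t(1)] in force)
  qed
  have only: "t = life x" if t: "0 < t" "t \<le> life x" and lim: "filterlim ?N at_top (at_left t)" for t
  proof (rule ccontr)
    assume "t \<noteq> life x"
    with t have t': "t < life x" by simp
    have "\<forall>\<^sub>F s in at_left t. ?N t \<le> ?N s" using lim by (simp add: filterlim_at_top)
    moreover have "\<forall>\<^sub>F s in at_left t. s \<in> {0<..<t}" using t(1) by (rule eventually_at_left_real)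
    ultimately have "\<forall>\<^sub>F s in at_left t. False"
    proof eventually_elim
      case (elim s)
      then show False using solution_norm_mono[OF x _ _ t', of s] by simp
    qed
    then show False by (simp add: eventually_False)
  qed
  obtain l where l: "lifespan b D x = ereal l" using lifespan_finite(1)[OF x] by blast
  then have life: "life x = l" by simp
  have "{ereal t | t. 0 < t \<and> ereal t \<le> lifespan b D x \<and> filterlim ?N at_top (at_left t)} = {ereal (life x)}"
    using top only lifespan_finite(2)[OF x] unfolding life l by auto
  then show ?thesis by (simp add: blowup_time_def)
qed

section \<open>The hitting time of a sphere\<close>

lemma hitting_time_eqI:
  assumes x: "x \<in> D" and t: "0 \<le> t" "t < life x" and r: "norm (sol x t) = r"
  shows "hitting_time b D r x = t"
  unfolding hitting_time_def
proof (rule Least_equality)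
  show "0 \<le> t \<and> ereal t < lifespan b D x \<and> r \<le> norm (sol x t)"
    using t r by (subst lifespan_finite(1)[OF x]) simp
  fix u assume u: "0 \<le> u \<and> ereal u < lifespan b D x \<and> r \<le> norm (sol x u)"
  then show "t \<le> u" using solution_norm_mono[OF x _ _ t(2), of u] r by force
qed

lemma hitting_time_props:
  assumes x: "x \<in> D" and r: "norm x < r"
  shows "0 < hitting_time b D r x" "hitting_time b D r x < life x"
    "norm (sol x (hitting_time b D r x)) = r"
proof -
  obtain T where T: "0 \<le> T" "T < life x" "r < norm (sol x T)" using solution_unbounded[OF x] by blast
  have "continuous_on {0..T} (sol x)"
    by (rule ivp_continuous[OF ivp_solution_life[OF x]]) (use T in auto)
  then have "continuous_on {0..T} (\<lambda>t. norm (sol x t))" by (intro continuous_intros)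
  then obtain t where t: "0 \<le> t" "t \<le> T" "norm (sol x t) = r"
    using IVT'[of "\<lambda>t. norm (sol x t)" 0 r T] T r solution_0[OF x] by auto
  then have H: "hitting_time b D r x = t" using T by (intro hitting_time_eqI[OF x]) auto
  have "t \<noteq> 0" using t(3) r solution_0[OF x] by auto
  then show "0 < hitting_time b D r x" "hitting_time b D r x < life x"
    "norm (sol x (hitting_time b D r x)) = r" using H t T by auto
qed

lemma hitting_time_flow:
  assumes x: "x \<in> D" and r: "norm x < r" and s: "0 \<le> s" "s \<le> hitting_time b D r x"
  shows "hitting_time b D r (sol x s) = hitting_time b D r x - s"
proof -
  note H = hitting_time_props[OF x r]
  have s': "s < life x" using s H by simp
  show ?thesis
    by (rule hitting_time_eqI)
      (use s H solution_in_D[OF x s(1) s'] solution_flow[OF x s(1) s'] in auto)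
qed

text \<open>The bound on the lifespan, applied to the solution restarted on the sphere.\<close>

lemma life_minus_hitting_time:
  assumes x: "x \<in> D" and r: "norm x < r"
  shows "0 \<le> life x - hitting_time b D r x" "life x - hitting_time b D r x \<le> r powr (- \<alpha>) / (c * \<alpha>)"
proof -
  note H = hitting_time_props[OF x r]
  have "life x - hitting_time b D r x = life (sol x (hitting_time b D r x))"
    using solution_flow(1)[OF x, of "hitting_time b D r x"] H by simp
  also have "\<dots> \<le> norm (sol x (hitting_time b D r x)) powr (- \<alpha>) / (c * \<alpha>)"
    using H by (intro lifespan_finite(3) solution_in_D[OF x]) auto
  finally show "life x - hitting_time b D r x \<le> r powr (- \<alpha>) / (c * \<alpha>)" using H by simp
qed (use hitting_time_props[OF x r] in auto)

lemma hitting_time_le: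
  assumes x: "x \<in> D" and r: "norm x < r"
  shows "hitting_time b D r x \<le> (norm x powr (- \<alpha>) - r powr (- \<alpha>)) / (c * \<alpha>)"
proof -
  note H = hitting_time_props[OF x r]
  have "r powr (- \<alpha>) \<le> norm x powr (- \<alpha>) - c * \<alpha> * hitting_time b D r x"
    using norm_powr_decay[OF ivp_solution_life[OF x], of 0 "hitting_time b D r x"] H solution_0[OF x]
    by simp
  then show ?thesis using c_pos alpha_pos by (simp add: field_simps)
qed

text \<open>Along the flow the hitting time is \<open>H(x) - t\<close>; the chain rule at \<open>t = 0\<close> gives the claim. A one-sided
derivative of the solution is enough.\<close>

lemma gradient_hitting_time_inner:
  assumes x: "x \<in> D" and r: "norm x < r" and g: "GDERIV (hitting_time b D r) x :> g"
  shows "b x \<bullet> g = -1"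
proof -
  let ?H = "hitting_time b D r"
  note H = hitting_time_props[OF x r]
  have sol: "(sol x has_vector_derivative b x) (at 0 within {0..})"
    using ivp_derivative(1)[OF ivp_solution_life[OF x], of 0] lifespan_finite(2)[OF x] solution_0[OF x]
    by simp
  have "(?H has_derivative (\<lambda>h. h \<bullet> g)) (at (sol x 0) within sol x ` {0..})"
    using g solution_0[OF x] unfolding gderiv_def by (auto intro: has_derivative_at_withinI)
  from vector_derivative_diff_chain_within[OF sol this]
  have "((\<lambda>t. ?H (sol x t)) has_vector_derivative (b x \<bullet> g)) (at 0 within {0..})"
    by (simp add: o_def)
  then have d1: "((\<lambda>t. ?H x - t) has_vector_derivative (b x \<bullet> g)) (at 0 within {0..})"
    by (rule has_vector_derivative_transform_within[of _ _ _ _ "?H x"])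
      (use H hitting_time_flow[OF x r] in \<open>auto simp: dist_real_def\<close>)
  have d2: "((\<lambda>t. ?H x - t) has_vector_derivative -1) (at 0 within {0..})"
    unfolding has_real_derivative_iff_has_vector_derivative[symmetric]
    by (auto intro!: derivative_eq_intros)
  have "at (0::real) within {0..} \<noteq> bot"
    by (simp add: at_within_Ici_at_right)
  then show ?thesis using d1 d2 by (rule vector_derivative_unique_within)
qed

section \<open>Euler steps and the stopping radius\<close>

text \<open>The squared norm of \<open>x + h b(x)\<close> is a quadratic polynomial in \<open>h\<close> with nonnegative coefficients.\<close>

lemma norm_euler_ge:
  assumes x: "x \<in> D" and h: "0 \<le> u" "u \<le> h"
  shows "norm (x + u *\<^sub>R b x) \<le> norm (x + h *\<^sub>R b x)"
proof (rule power2_le_imp_le)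
  have "norm (x + h *\<^sub>R b x) ^ 2 = norm x ^ 2 + 2 * h * (b x \<bullet> x) + h ^ 2 * norm (b x) ^ 2" for h
    unfolding power2_norm_eq_inner
    by (simp add: inner_add_left inner_add_right inner_commute power2_eq_square algebra_simps)
  then show "norm (x + u *\<^sub>R b x) ^ 2 \<le> norm (x + h *\<^sub>R b x) ^ 2"
    using h inner_b_nonneg[OF x] by (auto intro!: add_mono mult_right_mono power_mono)
qed simp

lemma euler_in_D:
  assumes x: "x \<in> D" and h: "0 \<le> h"
  shows "x + h *\<^sub>R b x \<in> D"
  using norm_euler_ge[OF x order_refl h] x by (simp add: D)

lemma radius_powr: "0 < \<epsilon> \<Longrightarrow> radius c \<alpha> \<epsilon> powr (- \<alpha>) = c * \<alpha> * \<epsilon>"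
  using c_pos alpha_pos by (simp add: radius_def powr_powr powr_minus)

lemma radius_pos: "0 < \<epsilon> \<Longrightarrow> 0 < radius c \<alpha> \<epsilon>"
  using c_pos alpha_pos by (simp add: radius_def)

lemma less_radius_iff: "0 < R \<Longrightarrow> 0 < \<epsilon> \<Longrightarrow> R < radius c \<alpha> \<epsilon> \<longleftrightarrow> c * \<alpha> * \<epsilon> < R powr (- \<alpha>)"
  using norm_powr_less_iff[OF radius_pos, of \<epsilon> R] by (simp add: radius_powr)

lemma eventually_less_radius: "\<forall>\<^sub>F \<epsilon> in at_right 0. R < radius c \<alpha> \<epsilon>"
proof -
  define R' where "R' = max R 1"
  have "0 < R' powr (- \<alpha>) / (c * \<alpha>)" using c_pos alpha_pos by (simp add: R'_def)
  then have "\<forall>\<^sub>F \<epsilon> in at_right 0. \<epsilon> \<in> {0<..<R' powr (- \<alpha>) / (c * \<alpha>)}"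
    by (rule eventually_at_right_real)
  then show ?thesis
  proof eventually_elim
    case (elim \<epsilon>)
    then have "R' < radius c \<alpha> \<epsilon>"
      using c_pos alpha_pos by (subst less_radius_iff) (auto simp: R'_def field_simps)
    then show ?case by (simp add: R'_def)
  qed
qed

abbreviation "J x \<equiv> matrix_norm2 (jacobian b (at x))"

lemma continuous_on_J: "continuous_on D J"
  using C1 by (intro continuous_on_matrix_norm2) (simp add: C1_on_def)

lemma euler_line_mvt:
  assumes x: "x \<in> D" and u: "0 < u"
  shows "\<exists>w\<in>{0<..<u}. norm (b (x + u *\<^sub>R b x) - b x) \<le> J (x + w *\<^sub>R b x) * (u * norm (b x))"
proof -
  let ?p = "\<lambda>w. x + w *\<^sub>R b x"
  have p: "(?p has_derivative (\<lambda>h. h *\<^sub>R b x)) (at w)" for w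
    by (auto intro!: derivative_eq_intros)
  have d: "((\<lambda>w. b (?p w)) has_derivative (\<lambda>h. jacobian b (at (?p w)) *v (h *\<^sub>R b x))) (at w)"
    if "0 \<le> w" for w
    using has_derivative_compose[OF p has_derivative_b[OF euler_in_D[OF x that]]] .
  have "\<exists>w\<in>{0<..<u}. norm (b (?p u) - b (?p 0)) \<le> norm (jacobian b (at (?p w)) *v ((u - 0) *\<^sub>R b x))"
    using u by (intro mvt_general d has_derivative_continuous_on[OF has_derivative_at_withinI[OF d]]) auto
  then obtain w where w: "w \<in> {0<..<u}"
    "norm (b (?p u) - b x) \<le> norm (jacobian b (at (?p w)) *v (u *\<^sub>R b x))" by auto
  note w(2)
  also have "\<dots> \<le> J (?p w) * (u * norm (b x))"
    using norm_matrix_vector_le[of "jacobian b (at (?p w))" "u *\<^sub>R b x"] u by simp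
  finally show ?thesis using w(1) by blast
qed

text \<open>Otherwise \<open>b\<close> would be constant on the ray, whereas the growth condition makes it unbounded there.\<close>

lemma J_not_zero_on_ray:
  assumes x: "x \<in> D" and zero: "\<And>s. 0 \<le> s \<Longrightarrow> J (x + s *\<^sub>R b x) = 0"
  shows False
proof -
  \<comment> \<open>A point with \<open>|y| \<ge> R\<close> has \<open>|b(y)| \<ge> 2 |b(x)|\<close>.\<close>
  define R where "R = (2 * norm (b x) / c) powr (1 / (1 + \<alpha>))"
  define s where "s = (R + norm x) / norm (b x)"
  let ?y = "x + s *\<^sub>R b x"
  have s: "0 < s"
    using norm_b_pos[OF x] norm_pos[OF x] by (auto simp: s_def R_def intro!: divide_pos_pos add_nonneg_pos)
  have y: "?y \<in> D" using euler_in_D[OF x] s by simp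
  have "norm (s *\<^sub>R b x) = R + norm x"
    using norm_b_pos[OF x] norm_pos[OF x] s by (simp add: s_def R_def)
  then have "R \<le> norm ?y" using norm_triangle_ineq2[of "s *\<^sub>R b x" "- x"] by (simp add: add.commute)
  have "2 * norm (b x) = c * R powr (1 + \<alpha>)"
    using c_pos alpha_pos norm_b_pos[OF x] by (simp add: R_def powr_powr)
  also have "\<dots> \<le> c * norm ?y powr (1 + \<alpha>)"
    using c_pos alpha_pos \<open>R \<le> norm ?y\<close> by (intro mult_left_mono powr_mono2) (auto simp: R_def)
  also have "\<dots> \<le> norm (b ?y)" by (rule norm_b_ge[OF y])
  also have "b ?y = b x" using euler_line_mvt[OF x s] zero by force
  finally show False using norm_b_pos[OF x] by simp
qed

end

section \<open>The error of one step\<close>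

text \<open>The second, fifth and sixth conditions of the theorem, with their constants made explicit.\<close>

locale euler_scheme = superlinear_field b D \<delta> c \<alpha>
  for b :: "real ^ 'n \<Rightarrow> real ^ 'n" and D and \<delta> c \<alpha> :: real +
  fixes G k h0 :: real
  assumes gradient_bound: "0 < \<epsilon> \<Longrightarrow> x \<in> D \<Longrightarrow> norm x < radius c \<alpha> \<epsilon> \<Longrightarrow>
        \<exists>g. GDERIV (hitting_time b D (radius c \<alpha> \<epsilon>)) x :> g \<and> norm g \<le> G / norm (b x)"
    and G: "0 < G" and k: "0 < k" and h0: "0 < h0"
    and norm_b_mono: "0 < h \<Longrightarrow> h \<le> h0 \<Longrightarrow> x \<in> D \<Longrightarrow> norm (b x) \<le> norm (b (x + h *\<^sub>R b x))"
    and J_control: "0 < \<epsilon> \<Longrightarrow> 0 < \<theta> \<Longrightarrow> \<theta> < 1 \<Longrightarrow> x \<in> D \<Longrightarrow> norm x < radius c \<alpha> \<epsilon> \<Longrightarrow>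
        J (x + ((\<epsilon> / sqrt (J x)) * \<theta>) *\<^sub>R b x) \<le> k * J x"
begin

lemma J_le_of_small_step:
  assumes "0 < \<epsilon>" "x \<in> D" "norm x < radius c \<alpha> \<epsilon>" "0 < J x" "0 < w" "w * sqrt (J x) < \<epsilon>"
  shows "J (x + w *\<^sub>R b x) \<le> k * J x"
proof -
  have "(\<epsilon> / sqrt (J x)) * (w * sqrt (J x) / \<epsilon>) = w" using assms by simp
  with J_control[of \<epsilon> "w * sqrt (J x) / \<epsilon>" x] show ?thesis using assms by simp
qed

text \<open>At a zero of \<open>J\<close> the quotient in \<open>J_control\<close> is a division by zero and the control is vacuous, so zeros
have to be excluded. Follow the ray \<open>x + s b(x)\<close> from a zero to the last point \<open>z\<close> up to which \<open>J\<close>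
vanishes. Up to \<open>z\<close> the field is constant, and \<open>z\<close> is a limit of points \<open>z\<^sub>n\<close> on the ray
with \<open>0 < J z\<^sub>n\<close>. Since \<open>J z\<^sub>n\<close> tends to \<open>0\<close>, the step sizes allowed in
\<open>J_control\<close> at \<open>z\<^sub>n\<close> grow beyond all bounds, and in the limit \<open>J\<close> vanishes on the
whole ray beyond \<open>z\<close> as well, which is impossible.\<close>

lemma J_pos:
  assumes x: "x \<in> D"
  shows "0 < J x"
proof (rule ccontr)
  assume "\<not> 0 < J x"
  then have J0: "J x = 0" using matrix_norm2_nonneg[of "jacobian b (at x)"] by simp
  let ?p = "\<lambda>s. x + s *\<^sub>R b x"
  define Z where "Z = {s. 0 \<le> s \<and> J (?p s) \<noteq> 0}"
  have "Z \<noteq> {}" using J_not_zero_on_ray[OF x] by (auto simp: Z_def)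
  have bdd: "bdd_below Z" by (rule bdd_belowI[of _ 0]) (simp add: Z_def)
  define a where "a = Inf Z"
  have a0: "0 \<le> a" unfolding a_def by (rule cInf_greatest[OF \<open>Z \<noteq> {}\<close>]) (simp add: Z_def)
  have before: "J (?p s) = 0" if "0 \<le> s" "s < a" for s
    using cInf_lower[OF _ bdd, of s] that by (auto simp: Z_def a_def)
  have contJ: "continuous_on {0..} (\<lambda>s. J (?p s))"
    by (rule continuous_on_compose2[OF continuous_on_J]) (auto intro!: continuous_intros euler_in_D[OF x])
  have Ja: "J (?p a) = 0"
  proof (cases "a = 0")
    case False
    then have "a \<in> closure {0..<a}" using a0 by simp
    moreover have "continuous_on (closure {0..<a}) (\<lambda>s. J (?p s))"
      by (rule continuous_on_subset[OF contJ]) (use a0 False in auto)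
    ultimately show ?thesis
      using continuous_constant_on_closure[of "{0..<a}" "\<lambda>s. J (?p s)" 0 a] before by auto
  qed (use J0 in simp)
  have ba: "b (?p a) = b x"
  proof (cases "a = 0")
    case False
    then obtain w where "w \<in> {0<..<a}" "norm (b (?p a) - b x) \<le> J (?p w) * (a * norm (b x))"
      using euler_line_mvt[OF x, of a] a0 by auto
    then show ?thesis using before[of w] by simp
  qed simp
  have "\<exists>s. s \<in> Z \<and> s < a + inverse (real (Suc n))" for n
    using cInf_less_iff[OF \<open>Z \<noteq> {}\<close> bdd, of "a + inverse (real (Suc n))"] by (auto simp: a_def)
  then obtain s where s: "\<And>n. s n \<in> Z" "\<And>n. s n < a + inverse (real (Suc n))" by metis
  have sa: "a \<le> s n" for n unfolding a_def by (rule cInf_lower[OF s(1) bdd])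
  have "(\<lambda>n. a + inverse (real (Suc n))) \<longlonglongrightarrow> a + 0"
    by (intro tendsto_intros LIMSEQ_inverse_real_of_nat)
  then have lim: "s \<longlonglongrightarrow> a"
    using tendsto_sandwich[of "\<lambda>_. a" s sequentially "\<lambda>n. a + inverse (real (Suc n))" a] sa s(2)
    by (auto intro: less_imp_le always_eventually)
  have plim: "(\<lambda>n. ?p (s n)) \<longlonglongrightarrow> ?p a"
    by (intro tendsto_intros lim)
  have pa: "?p a \<in> D" "\<And>n. ?p (s n) \<in> D"
    using euler_in_D[OF x] a0 sa order_trans by blast+
  have Jcont: "isCont J y" "isCont b y" if "y \<in> D" for y
    using continuous_on_J continuous_on_b open_D that by (auto simp: continuous_on_eq_continuous_at)
  have Jlim: "(\<lambda>n. J (?p (s n))) \<longlonglongrightarrow> 0"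
    using isCont_tendsto_compose[OF Jcont(1)[OF pa(1)] plim] Ja by simp
  have after: "J (?p (a + t)) = 0" if t: "0 < t" for t
  proof -
    have "\<forall>\<^sub>F \<epsilon> in at_right (0::real). 0 < \<epsilon> \<and> norm (?p a) < radius c \<alpha> \<epsilon>"
      by (intro eventually_conj eventually_less_radius eventually_at_right_less)
    then obtain \<epsilon> where \<epsilon>: "0 < \<epsilon>" "norm (?p a) < radius c \<alpha> \<epsilon>"
      using eventually_happens'[OF trivial_limit_at_right_real] by blast
    have "\<forall>\<^sub>F n in sequentially. norm (?p (s n)) < radius c \<alpha> \<epsilon>"
      by (rule order_tendstoD(2)[OF tendsto_norm[OF plim] \<epsilon>(2)])
    moreover have "(\<lambda>n. t * sqrt (J (?p (s n)))) \<longlonglongrightarrow> t * sqrt 0"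
      by (intro tendsto_intros Jlim)
    then have "\<forall>\<^sub>F n in sequentially. t * sqrt (J (?p (s n))) < \<epsilon>"
      using \<epsilon>(1) by (intro order_tendstoD(2)) auto
    ultimately have ev: "\<forall>\<^sub>F n in sequentially. J (?p (s n) + t *\<^sub>R b (?p (s n))) \<le> k * J (?p (s n))"
    proof eventually_elim
      case (elim n)
      have "0 < J (?p (s n))"
        using s(1)[of n] matrix_norm2_nonneg[of "jacobian b (at (?p (s n)))"] by (simp add: Z_def)
      then show ?case using J_le_of_small_step[OF \<epsilon>(1) pa(2) elim(1) _ t elim(2)] by simp
    qed
    have "(\<lambda>n. ?p (s n) + t *\<^sub>R b (?p (s n))) \<longlonglongrightarrow> ?p a + t *\<^sub>R b (?p a)"
      by (intro tendsto_intros plim isCont_tendsto_compose[OF Jcont(2)[OF pa(1)] plim])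
    then have "(\<lambda>n. J (?p (s n) + t *\<^sub>R b (?p (s n)))) \<longlonglongrightarrow> J (?p a + t *\<^sub>R b (?p a))"
      by (rule isCont_tendsto_compose[OF Jcont(1)[OF euler_in_D[OF pa(1)]], rotated]) (use t in simp)
    moreover have "(\<lambda>n. k * J (?p (s n))) \<longlonglongrightarrow> k * 0" by (intro tendsto_intros Jlim)
    ultimately have "J (?p a + t *\<^sub>R b (?p a)) \<le> k * 0"
      using ev by (intro tendsto_le[OF sequentially_bot])
    then show ?thesis
      using matrix_norm2_nonneg[of "jacobian b (at (?p (a + t)))"] by (simp add: ba algebra_simps)
  qed
  have "J (?p s) = 0" if "0 \<le> s" for s
    using before[OF that] Ja after[of "s - a"] by (cases s a rule: linorder_cases) auto
  then show False using J_not_zero_on_ray[OF x] by blast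
qed

lemma step_size_pos: "0 < \<epsilon> \<Longrightarrow> 0 < step_size b \<epsilon> x"
  by (simp add: step_size_def)

lemma step_size_le: "0 < \<epsilon> \<Longrightarrow> step_size b \<epsilon> x \<le> \<epsilon>"
  by (simp add: step_size_def field_simps)

lemma step_size_sqrt_J_le: "0 < \<epsilon> \<Longrightarrow> step_size b \<epsilon> x * sqrt (J x) \<le> \<epsilon>"
  by (simp add: step_size_def field_simps)

text \<open>The mean value theorem for \<open>H(x + u b(x)) + u\<close>. Its derivative at \<open>u\<close> is
\<open>(b(x) - b(x + u b(x))) \<bullet> g u\<close>, because the gradient \<open>g u\<close> satisfies \<open>b(x + u b(x)) \<bullet> g u = -1\<close>; this
is at most \<open>G k u J(x)\<close>, and \<open>h\<^sup>2 J(x) \<le> \<epsilon>\<^sup>2\<close>.\<close>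

lemma euler_step_error:
  assumes \<epsilon>: "0 < \<epsilon>" "\<epsilon> \<le> h0" and x: "x \<in> D" and h: "0 < h" "h \<le> step_size b \<epsilon> x"
    and r: "norm (x + h *\<^sub>R b x) < radius c \<alpha> \<epsilon>"
  shows "\<bar>hitting_time b D (radius c \<alpha> \<epsilon>) (x + h *\<^sub>R b x) + h - hitting_time b D (radius c \<alpha> \<epsilon>) x\<bar> \<le> G * k * \<epsilon>\<^sup>2"
proof -
  let ?r = "radius c \<alpha> \<epsilon>" and ?p = "\<lambda>u. x + u *\<^sub>R b x"
  let ?H = "hitting_time b D ?r"
  have p_in: "?p u \<in> D" "norm (?p u) < ?r" if "0 \<le> u" "u \<le> h" for u
    using euler_in_D[OF x that(1)] norm_euler_ge[OF x that] r by auto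
  have xr: "norm x < ?r" using p_in(2)[of 0] h by simp
  have "\<forall>u. \<exists>g. 0 \<le> u \<longrightarrow> u \<le> h \<longrightarrow> GDERIV ?H (?p u) :> g \<and> norm g \<le> G / norm (b (?p u))"
    using gradient_bound[OF \<epsilon>(1) p_in] by blast
  then obtain g where g: "\<And>u. 0 \<le> u \<Longrightarrow> u \<le> h \<Longrightarrow> GDERIV ?H (?p u) :> g u"
      "\<And>u. 0 \<le> u \<Longrightarrow> u \<le> h \<Longrightarrow> norm (g u) \<le> G / norm (b (?p u))" by metis
  have p: "(?p has_derivative (\<lambda>h. h *\<^sub>R b x)) (at w)" for w
    by (auto intro!: derivative_eq_intros)
  have d: "((\<lambda>u. ?H (?p u) + u) has_derivative (\<lambda>v. (v *\<^sub>R b x) \<bullet> g u + v)) (at u)" if "0 \<le> u" "u \<le> h" for u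
    using g(1)[OF that] unfolding gderiv_def
    by (intro has_derivative_add has_derivative_ident has_derivative_compose[OF p])
  have "\<exists>u\<in>{0<..<h}. norm ((?H (?p h) + h) - (?H (?p 0) + 0)) \<le> norm (((h - 0) *\<^sub>R b x) \<bullet> g u + (h - 0))"
    using h(1) by (intro mvt_general d has_derivative_continuous_on[OF has_derivative_at_withinI[OF d]]) auto
  then obtain u where u: "0 < u" "u < h"
    and mv: "\<bar>?H (?p h) + h - ?H x\<bar> \<le> \<bar>h * (b x \<bullet> g u) + h\<bar>" by auto
  have hJ: "h * sqrt (J x) \<le> \<epsilon>"
    using mult_right_mono[OF h(2), of "sqrt (J x)"] step_size_sqrt_J_le[OF \<epsilon>(1), of x]
      matrix_norm2_nonneg[of "jacobian b (at x)"] by simp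
  obtain w where w: "0 < w" "w < u" "norm (b (?p u) - b x) \<le> J (?p w) * (u * norm (b x))"
    using euler_line_mvt[OF x u(1)] by auto
  have "J (?p w) \<le> k * J x"
  proof (rule J_le_of_small_step[OF \<epsilon>(1) x xr J_pos[OF x] w(1)])
    have "w * sqrt (J x) < h * sqrt (J x)" using w u J_pos[OF x] by simp
    then show "w * sqrt (J x) < \<epsilon>" using hJ by simp
  qed
  then have diff: "norm (b (?p u) - b x) \<le> (k * J x) * (h * norm (b x))"
    using w u matrix_norm2_nonneg[of "jacobian b (at (?p w))"]
    by (intro order_trans[OF w(3)] mult_mono) auto
  have bu: "norm (b x) \<le> norm (b (?p u))"
    using u h step_size_le[OF \<epsilon>(1), of x] \<epsilon>(2) by (intro norm_b_mono x) auto
  have bx: "0 < norm (b x)" by (rule norm_b_pos[OF x])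
  have "b (?p u) \<bullet> g u = -1"
    using u by (intro gradient_hitting_time_inner[where r = ?r] p_in g) auto
  then have "b x \<bullet> g u + 1 = (b x - b (?p u)) \<bullet> g u" by (simp add: inner_diff_left)
  then have "\<bar>b x \<bullet> g u + 1\<bar> \<le> norm (b x - b (?p u)) * norm (g u)"
    using Cauchy_Schwarz_ineq2 by metis
  also have "\<dots> \<le> ((k * J x) * (h * norm (b x))) * (G / norm (b (?p u)))"
    using diff g(2)[of u] u h k J_pos[OF x] by (intro mult_mono) (auto simp: norm_minus_commute)
  also have "\<dots> \<le> ((k * J x) * (h * norm (b x))) * (G / norm (b x))"
    using bu bx G k h J_pos[OF x] by (intro mult_left_mono divide_left_mono mult_pos_pos) auto
  also have "\<dots> = G * k * (J x * h)" using bx by simp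
  finally have "h * \<bar>b x \<bullet> g u + 1\<bar> \<le> h * (G * k * (J x * h))"
    using h by (intro mult_left_mono) auto
  also have "\<dots> = G * k * (h * sqrt (J x))\<^sup>2"
    using J_pos[OF x] by (simp add: power2_eq_square)
  also have "\<dots> \<le> G * k * \<epsilon>\<^sup>2"
    using hJ G k h J_pos[OF x] by (intro mult_left_mono power_mono) auto
  also have "h * \<bar>b x \<bullet> g u + 1\<bar> = \<bar>h * (b x \<bullet> g u + 1)\<bar>"
    using h by (simp add: abs_mult)
  also have "\<dots> = \<bar>h * (b x \<bullet> g u) + h\<bar>" by (simp add: distrib_left)
  finally show ?thesis using mv by simp
qed

text \<open>Between the radii belonging to \<open>2 \<epsilon>\<close> and \<open>\<epsilon>\<close>, the norm to the power \<open>-\<alpha>\<close> varies by \<open>c \<alpha> \<epsilon>\<close>.\<close>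

lemma hitting_time_le_near_sphere:
  assumes \<epsilon>: "0 < \<epsilon>" and x: "x \<in> D" "radius c \<alpha> (2 * \<epsilon>) \<le> norm x" "norm x < radius c \<alpha> \<epsilon>"
  shows "hitting_time b D (radius c \<alpha> \<epsilon>) x \<le> \<epsilon>"
proof -
  have "norm x powr (- \<alpha>) \<le> radius c \<alpha> (2 * \<epsilon>) powr (- \<alpha>)"
    using x(2) radius_pos[of "2 * \<epsilon>"] \<epsilon> alpha_pos by (intro powr_mono2') auto
  also have "\<dots> = radius c \<alpha> \<epsilon> powr (- \<alpha>) + \<epsilon> * (c * \<alpha>)"
    using \<epsilon> by (simp add: radius_powr)
  finally have "(norm x powr (- \<alpha>) - radius c \<alpha> \<epsilon> powr (- \<alpha>)) / (c * \<alpha>) \<le> \<epsilon>"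
    using c_pos alpha_pos by (simp add: pos_divide_le_eq)
  then show ?thesis using hitting_time_le[OF x(1,3)] by simp
qed

text \<open>The error estimate of a step is available only inside the ball. So the crossing step is stopped on the
sphere belonging to \<open>2 \<epsilon>\<close>, from which the remaining hitting time is at most \<open>\<epsilon>\<close>.\<close>

lemma hitting_time_le_last_step:
  assumes \<epsilon>: "0 < \<epsilon>" "\<epsilon> \<le> h0" and x: "x \<in> D" "norm x < radius c \<alpha> \<epsilon>"
    and r: "radius c \<alpha> \<epsilon> \<le> norm (x + step_size b \<epsilon> x *\<^sub>R b x)"
  shows "hitting_time b D (radius c \<alpha> \<epsilon>) x \<le> 2 * \<epsilon> + G * k * \<epsilon>\<^sup>2"
proof (cases "radius c \<alpha> (2 * \<epsilon>) \<le> norm x")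
  case True
  then have "hitting_time b D (radius c \<alpha> \<epsilon>) x \<le> \<epsilon>"
    using \<epsilon> x by (intro hitting_time_le_near_sphere)
  moreover have "0 \<le> G * k * \<epsilon>\<^sup>2" using G k by simp
  ultimately show ?thesis using \<epsilon>(1) by linarith
next
  case False
  let ?h = "step_size b \<epsilon> x" and ?p = "\<lambda>u. x + u *\<^sub>R b x"
  let ?H = "hitting_time b D (radius c \<alpha> \<epsilon>)"
  have rr: "radius c \<alpha> (2 * \<epsilon>) < radius c \<alpha> \<epsilon>"
    using radius_pos[of "2 * \<epsilon>"] \<epsilon>(1) c_pos alpha_pos
    by (subst less_radius_iff) (auto simp: radius_powr)
  have "\<exists>u\<ge>0. u \<le> ?h \<and> norm (?p u) = radius c \<alpha> (2 * \<epsilon>)"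
    using False r rr step_size_pos[OF \<epsilon>(1), of x]
    by (intro IVT') (auto intro!: continuous_intros)
  then obtain u where u: "0 \<le> u" "u \<le> ?h" "norm (?p u) = radius c \<alpha> (2 * \<epsilon>)" by blast
  have u0: "0 < u" using u False by (cases "u = 0") auto
  have "?H (?p u) \<le> \<epsilon>"
    using u rr \<epsilon>(1) euler_in_D[OF x(1) u(1)] by (intro hitting_time_le_near_sphere) auto
  moreover have "\<bar>?H (?p u) + u - ?H x\<bar> \<le> G * k * \<epsilon>\<^sup>2"
    using u rr by (intro euler_step_error \<epsilon> x u0) auto
  ultimately show ?thesis using u step_size_le[OF \<epsilon>(1), of x] by linarith
qed

end

section \<open>The number of steps and the total error\<close>

text \<open>One rectangle of a lower Riemann sum against the integral of \<open>t\<^sup>-\<^sup>\<mu>\<close> over \<open>[a, s]\<close>.\<close>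

lemma left_sum_powr_le:
  fixes a s \<mu> :: real
  assumes "0 < a" "a \<le> s" "1 < \<mu>"
  shows "(s - a) / s powr \<mu> \<le> (a powr (1 - \<mu>) - s powr (1 - \<mu>)) / (\<mu> - 1)"
proof -
  define \<phi> where "\<phi> t = (a powr (1 - \<mu>) - t powr (1 - \<mu>)) / (\<mu> - 1) - (t - a) * s powr (- \<mu>)" for t
  have "\<phi> a \<le> \<phi> s"
  proof (rule DERIV_nonneg_imp_nondecreasing[OF assms(2)])
    fix t assume t: "a \<le> t" "t \<le> s"
    with assms have t0: "0 < t" by simp
    have "(\<phi> has_real_derivative (0 - (1 - \<mu>) * t powr (1 - \<mu> - 1)) / (\<mu> - 1) - (1 - 0) * s powr (- \<mu>)) (at t)"
      unfolding \<phi>_def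
      by (intro DERIV_diff DERIV_cdivide DERIV_cmult_right DERIV_const DERIV_ident has_real_derivative_powr t0)
    moreover have "(0 - (1 - \<mu>) * q) / (\<mu> - 1) = q" for q
      using assms by (simp add: field_simps)
    ultimately have "(\<phi> has_real_derivative t powr (- \<mu>) - s powr (- \<mu>)) (at t)" by simp
    moreover have "s powr (- \<mu>) \<le> t powr (- \<mu>)"
      using assms t0 t by (intro powr_mono2') auto
    then have "0 \<le> t powr (- \<mu>) - s powr (- \<mu>)" by simp
    ultimately show "\<exists>y. (\<phi> has_real_derivative y) (at t) \<and> 0 \<le> y" by blast
  qed
  then show ?thesis by (simp add: \<phi>_def powr_minus_divide)
qed

text \<open>What the first, third and fourth conditions of the theorem provide for counting steps: a size function \<open>S\<close>
that is equivalent to the norm and grows by a fixed fraction of the length of each Euler step, and a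
bound on the factor by which a step size falls short of \<open>\<epsilon>\<close>.\<close>

locale euler_cost = euler_scheme b D \<delta> c \<alpha> G k h0
  for b :: "real ^ 'n \<Rightarrow> real ^ 'n" and D and \<delta> c \<alpha> G k h0 :: real +
  fixes S :: "real ^ 'n \<Rightarrow> real" and Q A K \<mu> :: real
  assumes Q: "0 < Q" and A: "0 < A" and K: "0 < K" and \<mu>: "1 < \<mu>"
    and S_lower: "norm x \<le> S x" and S_upper: "S x \<le> Q * norm x"
    and S_step: "x \<in> D \<Longrightarrow> 0 \<le> h \<Longrightarrow> S x + A * (h * norm (b x)) \<le> S (x + h *\<^sub>R b x)"
    and speed: "x \<in> D \<Longrightarrow> sqrt (max (J x) 1) \<le> K * norm (b x) / norm x powr \<mu>"
begin

text \<open>The factor, up to \<open>1 / \<epsilon>\<close>, of the power of \<open>S\<close> in the potential below.\<close>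

definition "power_factor = K * (2 * Q) powr \<mu> / (A * (\<mu> - 1))"

lemma power_factor_nonneg: "0 \<le> power_factor"
  using K A \<mu> by (simp add: power_factor_def)

text \<open>Each step uses up one unit of a potential. A step that at least doubles \<open>S\<close> is paid for by the
logarithm. In any other step the two end points are comparable, and the bound \<open>speed\<close> at the start
of the step can be turned into the rectangle estimate, which needs its end.\<close>

lemma one_le_potential_drop:
  assumes \<epsilon>: "0 < \<epsilon>" and x: "x \<in> D"
  defines "y \<equiv> x + step_size b \<epsilon> x *\<^sub>R b x"
  shows "1 \<le> power_factor / \<epsilon> * (S x powr (1 - \<mu>) - S y powr (1 - \<mu>)) + (ln (S y) - ln (S x)) / ln 2"
proof -
  let ?h = "step_size b \<epsilon> x"
  have h: "0 < ?h" by (rule step_size_pos[OF \<epsilon>])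
  have nx: "0 < norm x" by (rule norm_pos[OF x])
  have Sx: "0 < S x" by (rule less_le_trans[OF nx S_lower])
  have inc: "S x + A * (?h * norm (b x)) \<le> S y"
    unfolding y_def using h by (intro S_step x) simp
  moreover have "0 \<le> A * (?h * norm (b x))" using A h by (intro mult_nonneg_nonneg) auto
  ultimately have Sxy: "S x \<le> S y" by linarith
  then have Sy: "0 < S y" using Sx by simp
  have drop: "(S y - S x) / S y powr \<mu> \<le> (S x powr (1 - \<mu>) - S y powr (1 - \<mu>)) / (\<mu> - 1)"
    by (rule left_sum_powr_le[OF Sx Sxy \<mu>])
  show ?thesis
  proof (cases "S y \<le> 2 * S x")
    case False
    then have "ln (2 * S x) \<le> ln (S y)" using Sx Sy by simp
    then have "ln 2 + ln (S x) \<le> ln (S y)" using Sx by (simp add: ln_mult)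
    then have "1 \<le> (ln (S y) - ln (S x)) / ln 2" by simp
    moreover have "0 \<le> S x powr (1 - \<mu>) - S y powr (1 - \<mu>)"
      using powr_mono2'[of "1 - \<mu>" "S x" "S y"] Sx Sxy \<mu> by simp
    then have "0 \<le> power_factor / \<epsilon> * (S x powr (1 - \<mu>) - S y powr (1 - \<mu>))"
      using power_factor_nonneg \<epsilon> by simp
    ultimately show ?thesis by linarith
  next
    case True
    have "S y \<le> (2 * Q) * norm x" using True S_upper[of x] by simp
    then have "S y powr \<mu> \<le> ((2 * Q) * norm x) powr \<mu>"
      using Sy \<mu> by (intro powr_mono2) auto
    also have "\<dots> = (2 * Q) powr \<mu> * norm x powr \<mu>"
      by (rule powr_mult)
    finally have pow: "S y powr \<mu> \<le> (2 * Q) powr \<mu> * norm x powr \<mu>" .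
    have "\<epsilon> = ?h * sqrt (max (J x) 1)" by (simp add: step_size_def)
    also have "\<dots> \<le> ?h * (K * norm (b x) / norm x powr \<mu>)"
      using h speed[OF x] by (intro mult_left_mono) auto
    also have "\<dots> = K * (?h * norm (b x)) * (1 / norm x powr \<mu>)" by simp
    also have "\<dots> \<le> K * ((S y - S x) / A) * ((2 * Q) powr \<mu> / S y powr \<mu>)"
    proof (intro mult_mono)
      show "?h * norm (b x) \<le> (S y - S x) / A" using inc A by (simp add: field_simps)
      show "1 / norm x powr \<mu> \<le> (2 * Q) powr \<mu> / S y powr \<mu>"
        using pow nx Sy by (simp add: field_simps)
    qed (use K Sxy A h in auto)
    also have "\<dots> = K * (2 * Q) powr \<mu> / A * ((S y - S x) / S y powr \<mu>)" by simp
    also have "\<dots> \<le> K * (2 * Q) powr \<mu> / A * ((S x powr (1 - \<mu>) - S y powr (1 - \<mu>)) / (\<mu> - 1))"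
      using drop K A by (intro mult_left_mono) auto
    also have "\<dots> = power_factor * (S x powr (1 - \<mu>) - S y powr (1 - \<mu>))"
      by (simp add: power_factor_def)
    finally have "1 \<le> power_factor / \<epsilon> * (S x powr (1 - \<mu>) - S y powr (1 - \<mu>))"
      using \<epsilon> by (simp add: field_simps)
    moreover have "0 \<le> (ln (S y) - ln (S x)) / ln 2" using Sx Sxy by simp
    ultimately show ?thesis by linarith
  qed
qed

context
  fixes x0 :: "real ^ 'n" and \<epsilon> :: real
  assumes x0: "x0 \<in> D" and \<epsilon>: "0 < \<epsilon>"
begin

abbreviation "X \<equiv> euler_point b \<epsilon> x0"
abbreviation "r \<equiv> radius c \<alpha> \<epsilon>"

lemma X_in_D: "X n \<in> D"
  by (induction n) (auto simp: x0 intro!: euler_in_D less_imp_le[OF step_size_pos[OF \<epsilon>]])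

lemma norm_X_strict_mono: "m < n \<Longrightarrow> norm (X m) < norm (X n)"
proof (rule lift_Suc_mono_less[of "\<lambda>n. norm (X n)"])
  fix n
  let ?x = "X n"
  have x: "?x \<in> D" by (rule X_in_D)
  have h: "0 < step_size b \<epsilon> ?x" by (rule step_size_pos[OF \<epsilon>])
  have "0 < b ?x \<bullet> ?x"
    using growth[OF x] c_pos norm_pos[OF x] by (intro less_le_trans[OF _ growth[OF x]]) auto
  then have "0 < step_size b \<epsilon> ?x * (b ?x \<bullet> ?x)" using h by simp
  then have "norm ?x ^ 2 < (?x + step_size b \<epsilon> ?x *\<^sub>R b ?x) \<bullet> ?x"
    by (simp add: power2_norm_eq_inner inner_add_left)
  also have "\<dots> \<le> norm (X (Suc n)) * norm ?x"
    using norm_cauchy_schwarz[of "X (Suc n)" ?x] by simp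
  finally show "norm ?x < norm (X (Suc n))"
    using norm_pos[OF x] by (simp add: power2_eq_square)
qed

lemma steps_le_potential_drop:
  "real n \<le> power_factor / \<epsilon> * (S x0 powr (1 - \<mu>) - S (X n) powr (1 - \<mu>)) + (ln (S (X n)) - ln (S x0)) / ln 2"
proof (induction n)
  case (Suc n)
  from one_le_potential_drop[OF \<epsilon> X_in_D[of n]] Suc show ?case
    by (simp add: right_diff_distrib diff_divide_distrib)
qed simp

definition "step_constant = power_factor * S x0 powr (1 - \<mu>) + (\<bar>ln (Q / S x0)\<bar> + 1 / (c * \<alpha>\<^sup>2)) / ln 2"

text \<open>Telescoping the potential; its logarithmic part is at most \<open>ln r + const\<close>, and \<open>ln r = O(1 / \<epsilon>)\<close>.\<close>

lemma steps_inside_le: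
  assumes \<epsilon>1: "\<epsilon> \<le> 1" and n: "norm (X n) \<le> r"
  shows "real n \<le> step_constant / \<epsilon>"
proof -
  have r: "0 < r" by (rule radius_pos[OF \<epsilon>])
  have S0: "0 < S x0" by (rule less_le_trans[OF norm_pos[OF x0] S_lower])
  have Sn: "0 < S (X n)" by (rule less_le_trans[OF norm_pos[OF X_in_D] S_lower])
  have "power_factor / \<epsilon> * (S x0 powr (1 - \<mu>) - S (X n) powr (1 - \<mu>)) \<le> power_factor / \<epsilon> * S x0 powr (1 - \<mu>)"
    using power_factor_nonneg \<epsilon> by (intro mult_left_mono) auto
  moreover have "(ln (S (X n)) - ln (S x0)) / ln 2 \<le> (\<bar>ln (Q / S x0)\<bar> + 1 / (c * \<alpha>\<^sup>2)) / \<epsilon> / ln 2"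
  proof (rule divide_right_mono)
    have "S (X n) \<le> Q * r"
      using S_upper[of "X n"] mult_left_mono[OF n, of Q] Q by linarith
    then have "ln (S (X n)) \<le> ln (Q * r)" using Sn by simp
    also have "\<dots> = ln Q + ln r" using Q r by (simp add: ln_mult)
    finally have "ln (S (X n)) - ln (S x0) \<le> ln (Q / S x0) + ln r"
      using Q S0 by (simp add: ln_div)
    moreover have "ln (Q / S x0) \<le> \<bar>ln (Q / S x0)\<bar> / \<epsilon>"
    proof -
      have "ln (Q / S x0) \<le> \<bar>ln (Q / S x0)\<bar> / 1" by simp
      also have "\<dots> \<le> \<bar>ln (Q / S x0)\<bar> / \<epsilon>" using \<epsilon> \<epsilon>1 by (intro divide_left_mono) auto
      finally show ?thesis .
    qed
    moreover have "ln r \<le> 1 / (c * \<alpha>\<^sup>2) / \<epsilon>"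
    proof -
      have "ln r = (1 / \<alpha>) * ln (1 / (c * \<alpha> * \<epsilon>))" by (simp add: radius_def ln_powr)
      also have "\<dots> \<le> (1 / \<alpha>) * (1 / (c * \<alpha> * \<epsilon>))"
        using c_pos alpha_pos \<epsilon> ln_bound[of "1 / (c * \<alpha> * \<epsilon>)"] by (intro mult_left_mono) auto
      finally show ?thesis by (simp add: power2_eq_square mult_ac)
    qed
    ultimately show "ln (S (X n)) - ln (S x0) \<le> (\<bar>ln (Q / S x0)\<bar> + 1 / (c * \<alpha>\<^sup>2)) / \<epsilon>"
      by (simp add: add_divide_distrib)
  qed simp
  moreover have split: "(power_factor * p + B / ln 2) / \<epsilon> = power_factor / \<epsilon> * p + B / \<epsilon> / ln 2" for p B
    by (simp add: add_divide_distrib mult.commute)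
  ultimately show ?thesis
    using steps_le_potential_drop[of n] unfolding step_constant_def split by linarith
qed

lemma terminates:
  assumes \<epsilon>1: "\<epsilon> \<le> 1"
  shows "euler_terminates b c \<alpha> x0 \<epsilon>"
proof (rule ccontr)
  assume "\<not> ?thesis"
  then have "norm (X n) \<le> r" for n by (auto simp: euler_terminates_def not_less)
  then have le: "real n \<le> step_constant / \<epsilon>" for n by (rule steps_inside_le[OF \<epsilon>1])
  obtain n where "step_constant / \<epsilon> < real n" using reals_Archimedean2 by blast
  with le[of n] show False by simp
qed

text \<open>Let \<open>M\<close> be the first index with \<open>r \<le> |X M|\<close>. The algorithm stops at \<open>M\<close>, or at the next index if
\<open>X M\<close> lies exactly on the sphere. Up to \<open>m = M - 1\<close> all points are strictly inside, where the hitting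
time is differentiable and the step errors add up; what follows \<open>m\<close> costs \<open>O(\<epsilon>)\<close> each: at most two more steps,
the hitting time from \<open>X m\<close>, and the time from the sphere to blow-up.\<close>

lemma euler_bounds:
  assumes \<epsilon>1: "\<epsilon> \<le> 1" "\<epsilon> \<le> h0" and start: "norm x0 < r"
  shows "real (euler_index b c \<alpha> x0 \<epsilon>) \<le> (step_constant + 2) / \<epsilon>"
    and "\<bar>euler_blowup_time b c \<alpha> x0 \<epsilon> - life x0\<bar> \<le> (5 + G * k * (step_constant + 1)) * \<epsilon>"
proof -
  let ?N = "euler_index b c \<alpha> x0 \<epsilon>" and ?t = "euler_time b \<epsilon> x0" and ?H = "hitting_time b D r"
  let ?E = "G * k * \<epsilon>\<^sup>2"
  obtain n0 where n0: "r < norm (X n0)"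
    using terminates[OF \<epsilon>1(1)] unfolding euler_terminates_def ..
  define M where "M = (LEAST n. r \<le> norm (X n))"
  have M: "r \<le> norm (X M)" unfolding M_def by (rule LeastI[of _ n0]) (rule less_imp_le[OF n0])
  have before: "norm (X n) < r" if "n < M" for n
    using not_less_Least[of n "\<lambda>n. r \<le> norm (X n)"] that by (simp add: M_def)
  have "M \<noteq> 0" using M start by (cases "M = 0") auto
  then obtain m where m: "M = Suc m" using not0_implies_Suc by blast
  have N: "?N = Suc m \<or> ?N = Suc (Suc m)"
  proof (cases "r < norm (X (Suc m))")
    case True
    have "?N = Suc m"
      unfolding euler_index_def
    proof (rule Least_equality[of "\<lambda>n. r < norm (X n)", OF True])
      fix n assume "r < norm (X n)"
      then show "Suc m \<le> n" using before[of n] m by force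
    qed
    then show ?thesis ..
  next
    case False
    have "?N = Suc (Suc m)"
      unfolding euler_index_def
    proof (rule Least_equality)
      show "r < norm (X (Suc (Suc m)))" using norm_X_strict_mono[of "Suc m" "Suc (Suc m)"] M m by simp
      fix n assume n: "r < norm (X n)"
      then have "n \<noteq> Suc m" using False by blast
      moreover have "\<not> n < Suc m" using before[of n] m n by force
      ultimately show "Suc (Suc m) \<le> n" by simp
    qed
    then show ?thesis ..
  qed
  have xm: "norm (X m) < r" using before m by simp
  have mB: "real m \<le> step_constant / \<epsilon>" using xm by (intro steps_inside_le \<epsilon>1(1)) simp
  have "real ?N \<le> real m + 2" using N by auto
  also have "\<dots> \<le> step_constant / \<epsilon> + 2 / \<epsilon>"
    using mB \<epsilon> \<epsilon>1(1) by (intro add_mono) (auto simp: field_simps)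
  finally show "real ?N \<le> (step_constant + 2) / \<epsilon>" by (simp add: add_divide_distrib)
  have err: "\<bar>?t n + ?H (X n) - ?H x0\<bar> \<le> real n * ?E" if "n < M" for n
    using that
  proof (induction n)
    case (Suc n)
    have "\<bar>?H (X (Suc n)) + step_size b \<epsilon> (X n) - ?H (X n)\<bar> \<le> ?E"
      using euler_step_error[OF \<epsilon> \<epsilon>1(2) X_in_D[of n] step_size_pos[OF \<epsilon>] order_refl] before[OF Suc.prems]
      by simp
    moreover have "\<bar>?t n + ?H (X n) - ?H x0\<bar> \<le> real n * ?E" using Suc by simp
    moreover have "?t (Suc n) = ?t n + step_size b \<epsilon> (X n)" by simp
    moreover have "real (Suc n) * ?E = real n * ?E + ?E" by (simp add: algebra_simps)
    ultimately show ?case by linarith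
  qed simp
  have "real m * ?E \<le> step_constant / \<epsilon> * ?E"
    using mB G k by (intro mult_right_mono) auto
  also have "\<dots> = G * k * step_constant * \<epsilon>" using \<epsilon> by (simp add: power2_eq_square)
  finally have e1: "\<bar>?t m + ?H (X m) - ?H x0\<bar> \<le> G * k * step_constant * \<epsilon>"
    using err[of m] m by simp
  have "\<epsilon>\<^sup>2 \<le> \<epsilon>" using \<epsilon> \<epsilon>1(1) by (simp add: power2_eq_square mult_left_le)
  then have E: "?E \<le> G * k * \<epsilon>" using G k by (intro mult_left_mono) auto
  have "?H (X m) \<le> 2 * \<epsilon> + ?E"
    using M m by (intro hitting_time_le_last_step[OF \<epsilon> \<epsilon>1(2) X_in_D xm]) simp
  then have e2: "?H (X m) \<le> 2 * \<epsilon> + G * k * \<epsilon>" "0 \<le> ?H (X m)"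
    using E hitting_time_props(1)[OF X_in_D xm] by auto
  have e3: "0 \<le> life x0 - ?H x0" "life x0 - ?H x0 \<le> \<epsilon>"
    using life_minus_hitting_time[OF x0 start] c_pos alpha_pos \<epsilon> by (auto simp: radius_powr)
  have "?t m \<le> ?t ?N \<and> ?t ?N \<le> ?t m + 2 * \<epsilon>"
    using N step_size_pos[OF \<epsilon>, of "X m"] step_size_le[OF \<epsilon>, of "X m"]
      step_size_pos[OF \<epsilon>, of "X (Suc m)"] step_size_le[OF \<epsilon>, of "X (Suc m)"]
    by (elim disjE) (auto simp del: euler_point.simps)
  then have "\<bar>?t ?N - life x0\<bar> \<le> G * k * step_constant * \<epsilon> + (2 * \<epsilon> + G * k * \<epsilon>) + \<epsilon> + 2 * \<epsilon>"
    using e1 e2 e3 by linarith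
  then show "\<bar>euler_blowup_time b c \<alpha> x0 \<epsilon> - life x0\<bar> \<le> (5 + G * k * (step_constant + 1)) * \<epsilon>"
    by (simp add: euler_blowup_time_def algebra_simps)
qed

end

end

section \<open>Blow-up time approximation and cost\<close>

lemma norm_euler_ge_of_angle:
  fixes x v :: "'a::real_inner"
  assumes x: "x \<noteq> 0" and C2: "C2 \<le> (v \<bullet> x) / (norm v * norm x)" and v: "v \<noteq> 0" and h: "0 \<le> h"
  shows "norm x + C2 * (h * norm v) \<le> norm (x + h *\<^sub>R v)"
proof -
  have "C2 * (norm v * norm x) \<le> v \<bullet> x" using C2 x v by (simp add: pos_le_divide_eq)
  then have "h * (C2 * (norm v * norm x)) \<le> h * (v \<bullet> x)" using h by (rule mult_left_mono)
  then have "(norm x + C2 * (h * norm v)) * norm x \<le> (x + h *\<^sub>R v) \<bullet> x"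
    by (simp add: inner_add_left algebra_simps power2_norm_eq_inner[symmetric] power2_eq_square)
  also have "\<dots> \<le> norm (x + h *\<^sub>R v) * norm x" by (rule norm_cauchy_schwarz)
  finally show ?thesis using x by simp
qed

text \<open>If \<open>v\<close> never points towards the coordinate hyperplanes, the absolute values of the
coordinates add up without cancellation.\<close>

lemma l1_norm_euler_ge:
  fixes x v :: "real ^ 'n"
  assumes "\<And>i. 0 \<le> x $ i * v $ i" and h: "0 \<le> h"
  shows "(\<Sum>i\<in>UNIV. \<bar>x $ i\<bar>) + h * norm v \<le> (\<Sum>i\<in>UNIV. \<bar>(x + h *\<^sub>R v) $ i\<bar>)"
proof -
  have "\<bar>(x + h *\<^sub>R v) $ i\<bar> = \<bar>x $ i\<bar> + h * \<bar>v $ i\<bar>" for i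
  proof -
    have "0 \<le> x $ i * (h * v $ i)"
      using mult_nonneg_nonneg[OF h assms(1)[of i]] by (simp add: mult_ac)
    then have "\<bar>x $ i + h * v $ i\<bar> = \<bar>x $ i\<bar> + \<bar>h * v $ i\<bar>"
      by (auto simp: zero_le_mult_iff)
    then show ?thesis using h by (simp add: abs_mult)
  qed
  then have "(\<Sum>i\<in>UNIV. \<bar>(x + h *\<^sub>R v) $ i\<bar>) = (\<Sum>i\<in>UNIV. \<bar>x $ i\<bar>) + h * (\<Sum>i\<in>UNIV. \<bar>v $ i\<bar>)"
    by (simp only: sum.distrib sum_distrib_left)
  then show ?thesis using mult_left_mono[OF norm_le_l1_cart[of v] h] by simp
qed

text \<open>The limit \<open>h \<down> 0\<close> of the hypothesis. It replaces the end point of a step, at which \<open>|b|\<close> may be much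
larger, by its starting point.\<close>

lemma (in superlinear_field) sqrt_J_le:
  assumes ev: "\<forall>\<^sub>F h in at_right 0. \<forall>x\<in>D. sqrt (J x) / norm (b (x + h *\<^sub>R b x)) \<le> C3 / norm (x + h *\<^sub>R b x) powr \<nu>"
    and x: "x \<in> D"
  shows "sqrt (J x) \<le> C3 * norm (b x) / norm x powr \<nu>"
proof -
  have "((\<lambda>h. x + h *\<^sub>R b x) \<longlongrightarrow> x + 0 *\<^sub>R b x) (at_right 0)"
    by (intro tendsto_intros)
  then have p: "((\<lambda>h. x + h *\<^sub>R b x) \<longlongrightarrow> x) (at_right 0)" by simp
  have cont: "isCont b x"
    using continuous_on_b open_D x by (auto simp: continuous_on_eq_continuous_at)
  have n: "norm x \<noteq> 0" "norm (b x) \<noteq> 0" using norm_pos[OF x] norm_b_pos[OF x] by auto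
  have l1: "((\<lambda>h. sqrt (J x) / norm (b (x + h *\<^sub>R b x))) \<longlongrightarrow> sqrt (J x) / norm (b x)) (at_right 0)"
    using n by (intro tendsto_divide tendsto_const tendsto_norm isCont_tendsto_compose[OF cont p]) auto
  have l2: "((\<lambda>h. C3 / norm (x + h *\<^sub>R b x) powr \<nu>) \<longlongrightarrow> C3 / norm x powr \<nu>) (at_right 0)"
    using n by (intro tendsto_divide tendsto_powr tendsto_const tendsto_norm p) auto
  have "sqrt (J x) / norm (b x) \<le> C3 / norm x powr \<nu>"
    by (rule tendsto_le[OF trivial_limit_at_right_real l2 l1]) (use ev x in \<open>auto elim: eventually_mono\<close>)
  then show ?thesis using norm_b_pos[OF x] by (simp add: field_simps)
qed

text \<open>Where \<open>J < 1\<close> the growth of \<open>|b|\<close> takes over, with exponent \<open>1 + \<alpha> > 1\<close>. Both exponents reduce to the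
smaller one because \<open>|x|\<close> is bounded below by \<open>\<delta>\<close>.\<close>

lemma (in superlinear_field) sqrt_max_J_le:
  assumes J: "\<And>x. x \<in> D \<Longrightarrow> sqrt (J x) \<le> C3 * norm (b x) / norm x powr \<nu>" and C3: "0 < C3" and \<nu>: "1 < \<nu>"
  defines "\<mu> \<equiv> min \<nu> (1 + \<alpha>)"
  defines "K \<equiv> C3 * \<delta> powr (\<mu> - \<nu>) + \<delta> powr (\<mu> - (1 + \<alpha>)) / c"
  assumes x: "x \<in> D"
  shows "sqrt (max (J x) 1) \<le> K * norm (b x) / norm x powr \<mu>"
proof -
  have \<delta>x: "\<delta> < norm x" using x by (simp add: D)
  have nx: "0 < norm x" by (rule norm_pos[OF x])
  have pw: "1 / norm x powr p \<le> \<delta> powr (\<mu> - p) / norm x powr \<mu>" if "\<mu> \<le> p" for p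
  proof -
    have "1 / norm x powr p = norm x powr (\<mu> - p) / norm x powr \<mu>"
      using nx by (simp add: powr_diff)
    also have "\<dots> \<le> \<delta> powr (\<mu> - p) / norm x powr \<mu>"
      using that \<delta>x delta by (intro divide_right_mono powr_mono2') auto
    finally show ?thesis .
  qed
  have "sqrt (J x) \<le> C3 * norm (b x) * (1 / norm x powr \<nu>)" using J[OF x] by simp
  also have "\<dots> \<le> C3 * norm (b x) * (\<delta> powr (\<mu> - \<nu>) / norm x powr \<mu>)"
    using C3 by (intro mult_left_mono pw) (auto simp: \<mu>_def)
  finally have 1: "sqrt (J x) \<le> C3 * \<delta> powr (\<mu> - \<nu>) * (norm (b x) / norm x powr \<mu>)" by (simp add: mult_ac)
  have "1 \<le> norm (b x) / c * (1 / norm x powr (1 + \<alpha>))"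
    using norm_b_ge[OF x] c_pos nx by (simp add: field_simps)
  also have "\<dots> \<le> norm (b x) / c * (\<delta> powr (\<mu> - (1 + \<alpha>)) / norm x powr \<mu>)"
    using c_pos by (intro mult_left_mono pw) (auto simp: \<mu>_def)
  finally have 2: "1 \<le> \<delta> powr (\<mu> - (1 + \<alpha>)) / c * (norm (b x) / norm x powr \<mu>)" by (simp add: mult_ac)
  have "sqrt (max (J x) 1) \<le> sqrt (J x) + 1"
    using matrix_norm2_nonneg[of "jacobian b (at x)"] by (simp add: max_def)
  also have "\<dots> \<le> K * (norm (b x) / norm x powr \<mu>)"
    using 1 2 unfolding K_def distrib_right by linarith
  finally show ?thesis by simp
qed

theorem theorem2:
  fixes b :: "real ^ 'n \<Rightarrow> real ^ 'n"
    and \<delta> c \<alpha> :: real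
    and D :: "(real ^ 'n) set"
    and x0 :: "real ^ 'n"
  assumes delta: "\<delta> > 0"
    and D: "D = {x. \<delta> < norm x}"
    and C1: "C1_on D b"
    and c_pos: "c > 0" and alpha_pos: "\<alpha> > 0"
    and cond1: "\<forall>x\<in>D. c * norm x powr (2 + \<alpha>) \<le> b x \<bullet> x"
    and cond2: "\<exists>C1>0. \<forall>\<epsilon>>0. \<forall>x\<in>D \<inter> ball 0 (radius c \<alpha> \<epsilon>).
        \<exists>g. GDERIV (hitting_time b D (radius c \<alpha> \<epsilon>)) x :> g \<and> norm g \<le> C1 / norm (b x)"
    and cond3: "(\<exists>C2. 0 < C2 \<and> C2 \<le> 1 \<and> (\<forall>x\<in>D. C2 \<le> (b x \<bullet> x) / (norm (b x) * norm x))) \<or>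
        (\<forall>x\<in>D. \<forall>i. x $ i * b x $ i \<ge> 0)"
    and cond4: "\<exists>C3 C4 \<nu> \<upsilon>. C3 > 0 \<and> C4 > 0 \<and> \<nu> > 1 \<and> \<upsilon> \<ge> max (1 - \<alpha>) 0 \<and>
        (\<forall>\<^sub>F h in at_right 0. \<forall>x\<in>D.
           sqrt (matrix_norm2 (jacobian b (at x))) / norm (b (x + h *\<^sub>R b x))
             \<le> C3 / norm (x + h *\<^sub>R b x) powr \<nu>) \<and>
        (\<forall>x\<in>D. matrix_norm2 (jacobian b (at x)) / norm (b x) \<le> C4 / norm x powr \<upsilon>)"
    and cond5: "\<forall>\<^sub>F h in at_right 0. \<forall>x\<in>D. norm (b x) \<le> norm (b (x + h *\<^sub>R b x))"
    and cond6: "\<exists>k>1. \<forall>\<epsilon>>0. \<forall>\<theta>\<in>{0<..<1}. \<forall>x\<in>D \<inter> ball 0 (radius c \<alpha> \<epsilon>).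
        matrix_norm2 (jacobian b
          (at (x + ((\<epsilon> / sqrt (matrix_norm2 (jacobian b (at x)))) * \<theta>) *\<^sub>R b x)))
        \<le> k * matrix_norm2 (jacobian b (at x))"
    and x0: "x0 \<in> D"
  shows "blowup_time b D x0 < \<infinity> \<and>
    (\<forall>\<^sub>F \<epsilon> in at_right 0. euler_terminates b c \<alpha> x0 \<epsilon>) \<and>
    (\<lambda>\<epsilon>. \<bar>euler_blowup_time b c \<alpha> x0 \<epsilon> - real_of_ereal (blowup_time b D x0)\<bar>)
      \<in> O[at_right 0](\<lambda>\<epsilon>. \<epsilon>) \<and>
    (\<lambda>\<epsilon>. real (euler_index b c \<alpha> x0 \<epsilon>)) \<in> O[at_right 0](\<lambda>\<epsilon>. inverse \<epsilon>)"
proof -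
  interpret superlinear_field b D \<delta> c \<alpha>
    using delta D C1 c_pos alpha_pos cond1 by unfold_locales auto
  obtain G where G: "0 < G" "\<And>\<epsilon> x. 0 < \<epsilon> \<Longrightarrow> x \<in> D \<Longrightarrow> norm x < radius c \<alpha> \<epsilon> \<Longrightarrow>
      \<exists>g. GDERIV (hitting_time b D (radius c \<alpha> \<epsilon>)) x :> g \<and> norm g \<le> G / norm (b x)"
    using cond2 by (auto simp: Ball_def)
  obtain k where k: "1 < k" "\<And>\<epsilon> \<theta> x. 0 < \<epsilon> \<Longrightarrow> 0 < \<theta> \<Longrightarrow> \<theta> < 1 \<Longrightarrow> x \<in> D \<Longrightarrow> norm x < radius c \<alpha> \<epsilon> \<Longrightarrow>
      J (x + ((\<epsilon> / sqrt (J x)) * \<theta>) *\<^sub>R b x) \<le> k * J x"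
    using cond6 by (auto simp: Ball_def)
  obtain h1 where h1: "0 < h1" "\<And>h x. 0 < h \<Longrightarrow> h < h1 \<Longrightarrow> x \<in> D \<Longrightarrow> norm (b x) \<le> norm (b (x + h *\<^sub>R b x))"
    using cond5 unfolding eventually_at_right_field by blast
  \<comment> \<open>The fifth condition holds on an open interval of step sizes; its lower half is closed on the right.\<close>
  interpret euler_scheme b D \<delta> c \<alpha> G k "h1 / 2"
    using G k h1 by unfold_locales auto
  obtain C3 \<nu> where C3: "0 < C3" "1 < \<nu>"
    and ev: "\<forall>\<^sub>F h in at_right 0. \<forall>x\<in>D. sqrt (J x) / norm (b (x + h *\<^sub>R b x)) \<le> C3 / norm (x + h *\<^sub>R b x) powr \<nu>"
    using cond4 by blast
  define \<mu> where "\<mu> = min \<nu> (1 + \<alpha>)"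
  define K where "K = C3 * \<delta> powr (\<mu> - \<nu>) + \<delta> powr (\<mu> - (1 + \<alpha>)) / c"
  have speed: "sqrt (max (J x) 1) \<le> K * norm (b x) / norm x powr \<mu>" if "x \<in> D" for x
    unfolding K_def \<mu>_def by (rule sqrt_max_J_le[OF sqrt_J_le[OF ev] C3 that])
  have \<mu>: "1 < \<mu>" using C3 alpha_pos by (simp add: \<mu>_def)
  have K: "0 < K" using C3 delta c_pos by (simp add: K_def add_pos_pos)
  have "\<exists>S Q A. 0 < Q \<and> 0 < A \<and> (\<forall>x. norm x \<le> S x \<and> S x \<le> Q * norm x) \<and>
      (\<forall>x\<in>D. \<forall>h\<ge>0. S x + A * (h * norm (b x)) \<le> S (x + h *\<^sub>R b x))"
    using cond3
  proof
    assume "\<exists>C2. 0 < C2 \<and> C2 \<le> 1 \<and> (\<forall>x\<in>D. C2 \<le> (b x \<bullet> x) / (norm (b x) * norm x))"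
    then obtain C2 where C2: "0 < C2" "\<And>x. x \<in> D \<Longrightarrow> C2 \<le> (b x \<bullet> x) / (norm (b x) * norm x)" by blast
    have "norm x + C2 * (h * norm (b x)) \<le> norm (x + h *\<^sub>R b x)" if "x \<in> D" "0 \<le> h" for x h
      using norm_pos[OF that(1)] norm_b_pos[OF that(1)]
      by (intro norm_euler_ge_of_angle C2(2) that) auto
    then show ?thesis using C2(1) by (intro exI[of _ norm] exI[of _ 1] exI[of _ C2]) auto
  next
    assume sgn: "\<forall>x\<in>D. \<forall>i. x $ i * b x $ i \<ge> 0"
    let ?S = "\<lambda>x::real^'n. \<Sum>i\<in>UNIV. \<bar>x $ i\<bar>"
    have "?S x \<le> real CARD('n) * norm x" for x
      using sum_bounded_above[of UNIV "\<lambda>i. \<bar>x $ i\<bar>" "norm x"] component_le_norm_cart[of x] by simp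
    moreover have "?S x + 1 * (h * norm (b x)) \<le> ?S (x + h *\<^sub>R b x)" if "x \<in> D" "0 \<le> h" for x h
      using l1_norm_euler_ge[of x "b x" h] sgn that by simp
    ultimately show ?thesis
      using norm_le_l1_cart
      by (intro exI[of _ ?S] exI[of _ "real CARD('n)"] exI[of _ 1]) (auto simp del: vector_add_component vector_scaleR_component)
  qed
  then obtain S Q A where "0 < Q" "0 < A" "\<And>x. norm x \<le> S x" "\<And>x. S x \<le> Q * norm x"
    "\<And>x h. x \<in> D \<Longrightarrow> 0 \<le> h \<Longrightarrow> S x + A * (h * norm (b x)) \<le> S (x + h *\<^sub>R b x)" by metis
  then interpret euler_cost b D \<delta> c \<alpha> G k "h1 / 2" S Q A K \<mu>
    using K \<mu> speed by unfold_locales auto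
  define B where "B = step_constant x0"
  have small: "\<forall>\<^sub>F \<epsilon> in at_right 0. 0 < \<epsilon> \<and> \<epsilon> \<le> 1 \<and> \<epsilon> \<le> h1 / 2 \<and> norm x0 < radius c \<alpha> \<epsilon>"
  proof -
    have "\<forall>\<^sub>F \<epsilon> in at_right (0::real). \<epsilon> \<in> {0<..<min 1 (h1 / 2)}"
      using h1 by (intro eventually_at_right_real) auto
    with eventually_less_radius[of "norm x0"] show ?thesis by eventually_elim auto
  qed
  have blowup: "blowup_time b D x0 = ereal (life x0)" by (rule blowup_time_eq_lifespan[OF x0])
  have "(\<lambda>\<epsilon>. real (euler_index b c \<alpha> x0 \<epsilon>)) \<in> O[at_right 0](\<lambda>\<epsilon>. inverse \<epsilon>)"
  proof (rule bigoI[where c = "B + 2"])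
    show "\<forall>\<^sub>F \<epsilon> in at_right 0. norm (real (euler_index b c \<alpha> x0 \<epsilon>)) \<le> (B + 2) * norm (inverse \<epsilon>)"
      using small
    proof eventually_elim
      case (elim \<epsilon>)
      then have "real (euler_index b c \<alpha> x0 \<epsilon>) \<le> (B + 2) / \<epsilon>"
        unfolding B_def by (intro euler_bounds(1)[OF x0]) auto
      then show ?case using elim by (simp add: inverse_eq_divide)
    qed
  qed
  moreover have "(\<lambda>\<epsilon>. \<bar>euler_blowup_time b c \<alpha> x0 \<epsilon> - real_of_ereal (blowup_time b D x0)\<bar>) \<in> O[at_right 0](\<lambda>\<epsilon>. \<epsilon>)"
  proof (rule bigoI[where c = "5 + G * k * (B + 1)"])
    show "\<forall>\<^sub>F \<epsilon> in at_right 0.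
        norm \<bar>euler_blowup_time b c \<alpha> x0 \<epsilon> - real_of_ereal (blowup_time b D x0)\<bar>
          \<le> (5 + G * k * (B + 1)) * norm \<epsilon>"
      using small
    proof eventually_elim
      case (elim \<epsilon>)
      then have "\<bar>euler_blowup_time b c \<alpha> x0 \<epsilon> - life x0\<bar> \<le> (5 + G * k * (B + 1)) * \<epsilon>"
        unfolding B_def by (intro euler_bounds(2)[OF x0]) auto
      then show ?case using elim by (simp add: blowup)
    qed
  qed
  moreover have "\<forall>\<^sub>F \<epsilon> in at_right 0. euler_terminates b c \<alpha> x0 \<epsilon>"
    using small by eventually_elim (rule terminates[OF x0]; simp)
  moreover have "blowup_time b D x0 < \<infinity>" by (simp add: blowup)
  ultimately show ?thesis by (intro conjI)
qed

end
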